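(* Let $L=(a_{k-l})_{k,l\in\mathbb Z}$ be a biinfinite hermitian positive definite Toeplitz matrix, let $\gamma>0$ and assume that $L\in\mathcal E_\gamma$, i.e. $|a_k|<C e^{-\gamma|k|}$ for all $k\in\mathbb Z$ and some constant $C>0$. Let $y=(y_k)_{k\in\mathbb Z}$ satisfy $|y_k|\le e^{-\gamma|k|}$ for all $k$, and let $x\in\ell^2(\mathbb Z)$ be the solution of $Lx=y$. For $n\ge1$ let $y^{(n)}=(y_k)_{k=-n+1}^{n-1}$, let $S_n$ be the Schur complement matrix attached to the circulant embedding of the section $L_n=(a_{k-l})_{k,l=-n+1}^{n-1}$ (defined in the context), and let $z^{(n)}$ be the solution of $S_nz^{(n)}=y^{(n)}$. Then there exist an $N$, a $\gamma_1$ with $0<\gamma_1<\gamma$ and a constant $c$ independent of $n$ such that for all $n>N$ the matrix $S_n$ is invertible and $$\|x-z^{(n)}\|\le c\,e^{-\gamma_1 n}.$$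
   Context: Biinfinite Toeplitz matrices act as bounded operators on $\ell^2(\mathbb Z)$; hermitian positive definite means self-adjoint, positive and boundedly invertible. $\|\cdot\|$ is the $\ell^2$-norm, and a vector indexed by $-n+1,\dots,n-1$ is identified with its extension by zero to an element of $\ell^2(\mathbb Z)$. Write $m=2n-1$ for the size of $L_n$. The circulant embedding of $L_n$ is the $2m\times 2m$ hermitian circulant matrix $$\begin{bmatrix}L_n & B_n^*\\ B_n & L_n\end{bmatrix},$$ whose entries are $c_{(k-l)\bmod 2m}$ with $c_j=a_j$ for $0\le j\le m-1$, $c_m=b_0$, and $c_j=\overline{a_{2m-j}}$ for $m+1\le j\le 2m-1$, where $b_0=a_m$ (when $a_m$ is real) or $b_0=0$. Thus $B_n$ is the $m\times m$ Toeplitz matrix with first row $(b_0,a_{m-1},a_{m-2},\dots,a_1)$. One sets $S_n=L_n-B_nL_n^{-1}B_n^*$. *)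

theory Defs
  imports
    "HOL-Analysis.Infinite_Sum"
    "Jordan_Normal_Form.Gauss_Jordan_Elimination"
    "Jordan_Normal_Form.Schur_Decomposition"
begin

section \<open>Operators and biinfinite matrices on the sequence space over the integers\<close>

definition ell2 :: "(int \<Rightarrow> complex) set" where
  "ell2 = {x. (\<lambda>k. (cmod (x k))\<^sup>2) summable_on UNIV}"

definition ell2_norm :: "(int \<Rightarrow> complex) \<Rightarrow> real" where
  "ell2_norm x = sqrt (\<Sum>\<^sub>\<infinity>k. (cmod (x k))\<^sup>2)"

definition ell2_inner :: "(int \<Rightarrow> complex) \<Rightarrow> (int \<Rightarrow> complex) \<Rightarrow> complex" where
  "ell2_inner x y = (\<Sum>\<^sub>\<infinity>k. x k * cnj (y k))"

definition ell2_bounded_op :: "((int \<Rightarrow> complex) \<Rightarrow> int \<Rightarrow> complex) \<Rightarrow> bool" where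
  "ell2_bounded_op T \<longleftrightarrow>
     (\<forall>x\<in>ell2. T x \<in> ell2) \<and>
     (\<forall>x\<in>ell2. \<forall>y\<in>ell2. T (\<lambda>k. x k + y k) = (\<lambda>k. T x k + T y k)) \<and>
     (\<forall>c. \<forall>x\<in>ell2. T (\<lambda>k. c * x k) = (\<lambda>k. c * T x k)) \<and>
     (\<exists>K. \<forall>x\<in>ell2. ell2_norm (T x) \<le> K * ell2_norm x)"

definition ell2_boundedly_invertible :: "((int \<Rightarrow> complex) \<Rightarrow> int \<Rightarrow> complex) \<Rightarrow> bool" where
  "ell2_boundedly_invertible T \<longleftrightarrow>
     (\<exists>R. ell2_bounded_op R \<and> (\<forall>x\<in>ell2. R (T x) = x \<and> T (R x) = x))"

definition bi_apply :: "(int \<Rightarrow> int \<Rightarrow> complex) \<Rightarrow> (int \<Rightarrow> complex) \<Rightarrow> int \<Rightarrow> complex" where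
  "bi_apply A x = (\<lambda>k. \<Sum>\<^sub>\<infinity>l. A k l * x l)"

text \<open>The summability clause is needed because \<^const>\<open>infsum\<close> is 0 on families that
  are not summable.\<close>

definition bi_bounded :: "(int \<Rightarrow> int \<Rightarrow> complex) \<Rightarrow> bool" where
  "bi_bounded A \<longleftrightarrow>
     (\<forall>x\<in>ell2. \<forall>k. (\<lambda>l. A k l * x l) summable_on UNIV) \<and> ell2_bounded_op (bi_apply A)"

text \<open>Positivity only asks for a nonnegative real part: by self-adjointness the quadratic form
  is real, and bounded invertibility makes it strictly positive.\<close>

definition bi_hermitian_pos_def :: "(int \<Rightarrow> int \<Rightarrow> complex) \<Rightarrow> bool" where
  "bi_hermitian_pos_def A \<longleftrightarrow>
     bi_bounded A \<and>
     (\<forall>x\<in>ell2. \<forall>y\<in>ell2. ell2_inner (bi_apply A x) y = ell2_inner x (bi_apply A y)) \<and>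
     (\<forall>x\<in>ell2. 0 \<le> Re (ell2_inner (bi_apply A x) x)) \<and>
     ell2_boundedly_invertible (bi_apply A)"

definition toeplitz :: "(int \<Rightarrow> complex) \<Rightarrow> int \<Rightarrow> int \<Rightarrow> complex" where
  "toeplitz a = (\<lambda>k l. a (k - l))"

section \<open>Finite sections\<close>

text \<open>Sections are indexed by the integers from \<open>-n+1\<close> to \<open>n-1\<close>; position \<open>i < 2 * n - 1\<close> of
  the vectors and matrices below stands for the index \<open>i - n + 1\<close>.\<close>

definition vec_section :: "(int \<Rightarrow> complex) \<Rightarrow> nat \<Rightarrow> complex vec" where
  "vec_section y n = vec (2 * n - 1) (\<lambda>i. y (int i - int n + 1))"

definition mat_section :: "(int \<Rightarrow> int \<Rightarrow> complex) \<Rightarrow> nat \<Rightarrow> complex mat" where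
  "mat_section A n =
     mat (2 * n - 1) (2 * n - 1) (\<lambda>(i, j). A (int i - int n + 1) (int j - int n + 1))"

definition extend_by_zero :: "nat \<Rightarrow> complex vec \<Rightarrow> int \<Rightarrow> complex" where
  "extend_by_zero n z =
     (\<lambda>k. if - int n + 1 \<le> k \<and> k \<le> int n - 1 then z $ nat (k + int n - 1) else 0)"

section \<open>Circulant embedding and Schur complement\<close>

definition circ_coeff :: "(int \<Rightarrow> complex) \<Rightarrow> complex \<Rightarrow> nat \<Rightarrow> nat \<Rightarrow> complex" where
  "circ_coeff a b0 m j =
     (if j < m then a (int j) else if j = m then b0 else cnj (a (int (2 * m - j))))"

definition circ_embedding :: "(int \<Rightarrow> complex) \<Rightarrow> complex \<Rightarrow> nat \<Rightarrow> complex mat" where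
  "circ_embedding a b0 n = (let m = 2 * n - 1 in
     mat (2 * m) (2 * m)
       (\<lambda>(k, l). circ_coeff a b0 m (nat ((int k - int l) mod int (2 * m)))))"

definition circ_B :: "(int \<Rightarrow> complex) \<Rightarrow> complex \<Rightarrow> nat \<Rightarrow> complex mat" where
  "circ_B a b0 n =
     (case split_block (circ_embedding a b0 n) (2 * n - 1) (2 * n - 1) of
        (_, _, B, _) \<Rightarrow> B)"

definition schur_compl :: "(int \<Rightarrow> complex) \<Rightarrow> complex \<Rightarrow> nat \<Rightarrow> complex mat" where
  "schur_compl a b0 n = (let L = mat_section (toeplitz a) n; B = circ_B a b0 n in
     L - B * the (mat_inverse L) * mat_adjoint B)"

text \<open>The block form of the embedding, and the entries of its lower left block.\<close>

lemma circ_B_index: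
  assumes "i < 2 * n - 1" "j < 2 * n - 1"
  shows "circ_B a b0 n $$ (i, j) = circ_coeff a b0 (2 * n - 1) (2 * n - 1 + i - j)"
proof -
  define m where "m = 2 * n - 1"
  have "(int (m + i) - int j) mod int (2 * m) = int (m + i - j)"
    using assms by (subst mod_pos_pos_trivial) (auto simp: m_def)
  then have "nat ((int (m + i) - int j) mod int (2 * m)) = m + i - j" by linarith
  then show ?thesis
    using assms unfolding circ_B_def circ_embedding_def split_block_def Let_def m_def[symmetric]
    by (simp add: algebra_simps)
qed

lemma circ_B_carrier: "circ_B a b0 n \<in> carrier_mat (2 * n - 1) (2 * n - 1)"
  unfolding circ_B_def circ_embedding_def split_block_def Let_def by simp

lemma circ_embedding_block:
  assumes herm: "\<And>k. a (- k) = cnj (a k)" and b0: "b0 \<in> \<real>"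
  defines "L \<equiv> mat_section (toeplitz a)" and "B \<equiv> circ_B a b0"
  shows "circ_embedding a b0 n = four_block_mat (L n) (mat_adjoint (B n)) (B n) (L n)"
proof (rule eq_matI)
  define m where "m = 2 * n - 1"
  have LB: "L n \<in> carrier_mat m m" "B n \<in> carrier_mat m m"
    unfolding L_def B_def m_def mat_section_def using circ_B_carrier by auto
  have adj: "mat_adjoint (B n) $$ (i, j) = cnj (B n $$ (j, i))" if "i < m" "j < m" for i j
    using LB(2) that unfolding mat_adjoint_def by (simp add: mat_of_rows_index)
  have Bent: "B n $$ (i, j) = circ_coeff a b0 m (m + i - j)" if "i < m" "j < m" for i j
    unfolding B_def m_def using circ_B_index that m_def by simp
  have Lent: "L n $$ (i, j) = a (int i - int j)" if "i < m" "j < m" for i j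
    using that unfolding L_def mat_section_def toeplitz_def m_def by simp
  have diag: "circ_coeff a b0 m (nat ((int i - int j) mod int (2 * m))) = a (int i - int j)"
    if "i < m" "j < m" for i j
  proof (cases "j \<le> i")
    case True
    then have "(int i - int j) mod int (2 * m) = int i - int j"
      using that by (subst mod_pos_pos_trivial) auto
    then show ?thesis using that True by (simp add: circ_coeff_def nat_less_iff)
  next
    case False
    have "(int i - int j) mod int (2 * m) = (int i - int j + int (2 * m)) mod int (2 * m)"
      by simp
    also have "\<dots> = int (2 * m + i - j)"
      using that False by (subst mod_pos_pos_trivial) auto
    finally have "nat ((int i - int j) mod int (2 * m)) = 2 * m + i - j" by simp
    moreover have "\<not> 2 * m + i - j < m" "2 * m + i - j \<noteq> m" "2 * m - (2 * m + i - j) = j - i"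
      using that False by auto
    moreover have "cnj (a (int (j - i))) = a (int i - int j)"
      using herm[of "int (j - i)"] False by (simp add: of_nat_diff)
    ultimately show ?thesis by (simp add: circ_coeff_def)
  qed
  have b0c: "cnj b0 = b0" using b0 Reals_cnj_iff by blast
  have hermc: "cnj (circ_coeff a b0 m (m + j - i)) = circ_coeff a b0 m (m + i - j)"
    if "i < m" "j < m" for i j
    using that b0c by (cases i j rule: linorder_cases) (auto simp: circ_coeff_def)
  fix i j assume "i < dim_row (four_block_mat (L n) (mat_adjoint (B n)) (B n) (L n))"
    and "j < dim_col (four_block_mat (L n) (mat_adjoint (B n)) (B n) (L n))"
  then have ij: "i < 2 * m" "j < 2 * m" using LB by auto
  have C: "circ_embedding a b0 n $$ (i, j)
      = circ_coeff a b0 m (nat ((int i - int j) mod int (2 * m)))"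
    using ij unfolding circ_embedding_def Let_def m_def[symmetric] by simp
  have F: "four_block_mat (L n) (mat_adjoint (B n)) (B n) (L n) $$ (i, j)
      = (if i < m then if j < m then L n $$ (i, j) else mat_adjoint (B n) $$ (i, j - m)
         else if j < m then B n $$ (i - m, j) else L n $$ (i - m, j - m))"
    using ij LB by (subst index_mat_four_block) auto
  consider "i < m" "j < m" | "i < m" "m \<le> j" | "m \<le> i" "j < m" | "m \<le> i" "m \<le> j"
    by linarith
  then show "circ_embedding a b0 n $$ (i, j)
      = four_block_mat (L n) (mat_adjoint (B n)) (B n) (L n) $$ (i, j)"
  proof cases
    case 1
    then show ?thesis using C F diag Lent by simp
  next
    case 2
    then have j': "j - m < m" using ij by simp
    have "(int i - int j) mod int (2 * m) = (int i - int j + int (2 * m)) mod int (2 * m)"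
      by simp
    also have "\<dots> = int (m + i - (j - m))"
      using ij 2 by (subst mod_pos_pos_trivial) auto
    finally have "nat ((int i - int j) mod int (2 * m)) = m + i - (j - m)" by linarith
    then show ?thesis
      using C F 2 j' adj[of i "j - m"] Bent[of "j - m" i] hermc[of i "j - m"] by simp
  next
    case 3
    then have "(int i - int j) mod int (2 * m) = int (m + (i - m) - j)"
      using ij by (subst mod_pos_pos_trivial) auto
    then have "nat ((int i - int j) mod int (2 * m)) = m + (i - m) - j" by linarith
    moreover have "i - m < m" using 3 ij by simp
    ultimately show ?thesis using C F 3 Bent[of "i - m" j] by simp
  next
    case 4
    then have "int i - int j = int (i - m) - int (j - m)" by simp
    then show ?thesis using C F 4 ij diag[of "i - m" "j - m"] Lent[of "i - m" "j - m"] by simp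
  qed
qed (auto simp: circ_embedding_def L_def B_def mat_section_def Let_def)

end

theory Submission
  imports Defs
begin

text \<open>Bounded invertibility of $L$ on $\ell^2$ survives conjugation with the weights
  $e^{-2\varepsilon|l-k_0|}$ for small $\varepsilon$.  This gives a pointwise estimate for bounded
  sequences: if $|(Lw)_l| \le M e^{\varepsilon|l-k_0|}$ for all $l$, then $|w_{k_0}| \le K M$.
  With $w = x$ it yields the exponential decay of $x$.  By block elimination $z^{(n)}$ is the
  second half of the solution of the circulant system with right-hand side $(0, y^{(n)})$.  Let $W$ be
  the $2m$-periodic extension of that solution, shifted so that $z^{(n)}$ sits on $|k| < n$.  On
  periodic sequences the circulant matrix differs from $L$ by $O(e^{-\gamma m/2})$, so the
  estimate bounds $W$ uniformly in $n$; in particular $S_n$ is injective.  Finally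
  $L(x - W)$ is exponentially small on $|l| \le 3n - 2$ and bounded elsewhere, so the estimate
  at $|k_0| < n$ makes $x - z^{(n)}$ exponentially small there.\<close>

section \<open>Square summable sequences\<close>

text \<open>A two-sided geometric series: the integers are covered by the images of n and -n, whose
  overlap at 0 does no harm, and the centre \<open>i\<close> is reached by translation.\<close>

lemma exp_neg_abs_summable:
  fixes c :: real
  assumes "c > 0"
  shows "(\<lambda>j::int. exp (- c * real_of_int \<bar>j - i\<bar>)) summable_on UNIV"
proof -
  let ?f = "\<lambda>j::int. exp (- c * real_of_int \<bar>j\<bar>)"
  have "summable (\<lambda>n. exp (- c) ^ n)"
    using assms by (intro summable_geometric) auto
  then have nat: "(\<lambda>n::nat. exp (- c * real n)) summable_on UNIV"
    by (intro summable_nonneg_imp_summable_on) (simp_all add: exp_of_nat_mult[symmetric] mult.commute)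
  have "?f summable_on range int"
    using nat by (subst summable_on_reindex) (auto simp: o_def)
  moreover have "?f summable_on range (\<lambda>n. - int n)"
    using nat by (subst summable_on_reindex) (auto simp: o_def inj_on_def)
  ultimately have "?f summable_on (range int \<union> range (\<lambda>n. - int n))"
    by (rule summable_on_union)
  also have "range int \<union> range (\<lambda>n. - int n) = UNIV"
    by (auto simp: image_iff) (metis int_cases2)
  finally have "?f summable_on UNIV" .
  then show ?thesis
    using summable_on_reindex_bij_betw[of "\<lambda>j. j - i" UNIV UNIV ?f]
    by (simp add: bij_diff_right)
qed

lemma infsum_exp_neg_abs_shift:
  fixes c :: real
  shows "(\<Sum>\<^sub>\<infinity>j::int. exp (- c * real_of_int \<bar>j - i\<bar>)) = (\<Sum>\<^sub>\<infinity>j::int. exp (- c * real_of_int \<bar>j\<bar>))"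
  using infsum_reindex_bij_betw[of "\<lambda>j. j - i" UNIV UNIV "\<lambda>j. exp (- c * real_of_int \<bar>j\<bar>)"]
  by (simp add: bij_diff_right)

lemma ell2_norm_power2: "(ell2_norm u)\<^sup>2 = (\<Sum>\<^sub>\<infinity>k. (cmod (u k))\<^sup>2)"
  unfolding ell2_norm_def by (simp add: infsum_nonneg)

lemma ell2_comparison:
  assumes "g summable_on UNIV" "\<And>k. (cmod (u k))\<^sup>2 \<le> g k"
  shows "u \<in> ell2" "(ell2_norm u)\<^sup>2 \<le> (\<Sum>\<^sub>\<infinity>k. g k)"
proof -
  have *: "(\<lambda>k. (cmod (u k))\<^sup>2) summable_on UNIV"
    using assms by (intro summable_on_comparison_test[OF assms(1)]) auto
  then show "u \<in> ell2" by (simp add: ell2_def)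
  show "(ell2_norm u)\<^sup>2 \<le> (\<Sum>\<^sub>\<infinity>k. g k)"
    unfolding ell2_norm_power2 using * assms by (intro infsum_mono) auto
qed

lemma ell2_coord_le:
  assumes "u \<in> ell2"
  shows "(cmod (u k))\<^sup>2 \<le> (ell2_norm u)\<^sup>2"
  using finite_sum_le_infsum[of "\<lambda>k. (cmod (u k))\<^sup>2" UNIV "{k}"] assms
  unfolding ell2_norm_power2 by (simp add: ell2_def)

lemma ell2_norm_eq_0: "u \<in> ell2 \<Longrightarrow> ell2_norm u = 0 \<Longrightarrow> u k = 0"
  using ell2_coord_le[of u k] by simp

text \<open>From 2ab \<le> a^2 + b^2. The form with squared norms suits the later absorption
  argument, which compares squares.\<close>

lemma ell2_add:
  assumes "u \<in> ell2" "v \<in> ell2"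
  shows "(\<lambda>k. u k + v k) \<in> ell2"
    and "(ell2_norm (\<lambda>k. u k + v k))\<^sup>2 \<le> 2 * (ell2_norm u)\<^sup>2 + 2 * (ell2_norm v)\<^sup>2"
proof -
  let ?g = "\<lambda>k. 2 * (cmod (u k))\<^sup>2 + 2 * (cmod (v k))\<^sup>2"
  have s: "(\<lambda>k. 2 * (cmod (u k))\<^sup>2) summable_on UNIV" "(\<lambda>k. 2 * (cmod (v k))\<^sup>2) summable_on UNIV"
    using assms by (auto simp: ell2_def intro: summable_on_cmult_right)
  have le: "(cmod (u k + v k))\<^sup>2 \<le> ?g k" for k
  proof -
    have "(cmod (u k + v k))\<^sup>2 \<le> (cmod (u k) + cmod (v k))\<^sup>2"
      by (intro power_mono norm_triangle_ineq) auto
    also have "\<dots> \<le> ?g k" using sum_squares_bound[of "cmod (u k)" "cmod (v k)"]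
      by (simp add: power2_sum)
    finally show ?thesis .
  qed
  note c = ell2_comparison[OF summable_on_add[OF s], OF le]
  show "(\<lambda>k. u k + v k) \<in> ell2" by (rule c(1))
  have "(\<Sum>\<^sub>\<infinity>k. ?g k) = 2 * (ell2_norm u)\<^sup>2 + 2 * (ell2_norm v)\<^sup>2"
    unfolding ell2_norm_power2 using s by (subst infsum_add) (auto simp: infsum_cmult_right')
  with c(2) show "(ell2_norm (\<lambda>k. u k + v k))\<^sup>2 \<le> 2 * (ell2_norm u)\<^sup>2 + 2 * (ell2_norm v)\<^sup>2"
    by simp
qed

lemma ell2_cmult: "u \<in> ell2 \<Longrightarrow> (\<lambda>k. c * u k) \<in> ell2"
  unfolding ell2_def by (auto simp: norm_mult power_mult_distrib intro: summable_on_cmult_right)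

lemma ell2_inner_summable:
  assumes "u \<in> ell2" "v \<in> ell2"
  shows "(\<lambda>k. u k * cnj (v k)) summable_on UNIV"
proof (rule abs_summable_summable, rule abs_summable_on_comparison_test')
  show "(\<lambda>k. (cmod (u k))\<^sup>2 + (cmod (v k))\<^sup>2) summable_on UNIV"
    using assms by (intro summable_on_add) (auto simp: ell2_def)
  show "cmod (u k * cnj (v k)) \<le> (cmod (u k))\<^sup>2 + (cmod (v k))\<^sup>2" for k
  proof -
    have "cmod (u k) * cmod (v k) \<ge> 0" by simp
    then show ?thesis
      using sum_squares_bound[of "cmod (u k)" "cmod (v k)"] unfolding norm_mult complex_mod_cnj by linarith
  qed
qed

lemma ell2_inner_self:
  assumes "u \<in> ell2"
  shows "ell2_inner u u = complex_of_real ((ell2_norm u)\<^sup>2)"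
proof -
  have "((\<lambda>k. (cmod (u k))\<^sup>2) has_sum (ell2_norm u)\<^sup>2) UNIV"
    using assms unfolding ell2_norm_power2 ell2_def by simp
  then have "((\<lambda>k. complex_of_real ((cmod (u k))\<^sup>2)) has_sum of_real ((ell2_norm u)\<^sup>2)) UNIV"
    by (rule has_sum_of_real)
  then show ?thesis
    unfolding ell2_inner_def complex_norm_square by (rule infsumI)
qed

lemma ell2_inner_add_left:
  assumes "u \<in> ell2" "v \<in> ell2" "w \<in> ell2"
  shows "ell2_inner (\<lambda>k. u k + c * v k) w = ell2_inner u w + c * ell2_inner v w"
  unfolding ell2_inner_def using assms
  by (simp add: distrib_right mult.assoc infsum_add ell2_inner_summable
      summable_on_cmult_right infsum_cmult_right')

lemma ell2_inner_add_right:
  assumes "u \<in> ell2" "v \<in> ell2" "w \<in> ell2"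
  shows "ell2_inner w (\<lambda>k. u k + c * v k) = ell2_inner w u + cnj c * ell2_inner w v"
  unfolding ell2_inner_def using assms
  by (simp add: distrib_left mult.left_commute infsum_add ell2_inner_summable
      summable_on_cmult_right infsum_cmult_right')

lemma ell2_finite_support: "finite {k. u k \<noteq> 0} \<Longrightarrow> u \<in> ell2"
  unfolding ell2_def by (auto intro: finite_nonzero_values_imp_summable_on)

lemma has_sum_sum:
  fixes f :: "'a \<Rightarrow> 'b \<Rightarrow> 'c::topological_comm_monoid_add"
  assumes "\<And>k. k \<in> F \<Longrightarrow> (f k has_sum S k) A"
  shows "((\<lambda>l. \<Sum>k\<in>F. f k l) has_sum (\<Sum>k\<in>F. S k)) A"
  using assms by (induction F rule: infinite_finite_induct) (auto intro: has_sum_add)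

text \<open>Cauchy-Schwarz for the weights \<open>h (k - l)\<close>, read off from the nonnegative
  sum of \<open>h (k - l) * (u l - t)^2\<close>. Boundedness of \<open>u\<close> makes all series
  converge.\<close>

lemma convolution_cauchy_schwarz:
  fixes h u :: "int \<Rightarrow> real"
  assumes h: "h summable_on UNIV" "\<And>j. h j \<ge> 0" "(\<Sum>\<^sub>\<infinity>j. h j) \<le> H" "H > 0"
    and u: "\<And>j. u j \<ge> 0" "\<And>j. u j \<le> B"
  shows "(\<Sum>\<^sub>\<infinity>l. h (k - l) * u l)\<^sup>2 \<le> H * (\<Sum>\<^sub>\<infinity>l. h (k - l) * (u l)\<^sup>2)"
    and "(\<lambda>l. h (k - l) * u l) summable_on UNIV"
    and "(\<lambda>l. h (k - l) * (u l)\<^sup>2) summable_on UNIV"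
proof -
  have bij: "bij_betw (\<lambda>l. k - l) UNIV (UNIV :: int set)"
    by (rule bij_betw_byWitness[where f' = "\<lambda>l. k - l"]) auto
  have hk: "(\<lambda>l. h (k - l)) summable_on UNIV"
    using h(1) summable_on_reindex_bij_betw[OF bij, of h] by simp
  have hk_sum: "(\<Sum>\<^sub>\<infinity>l. h (k - l)) \<le> H"
    using h(3) infsum_reindex_bij_betw[OF bij, of h] by simp
  show s1: "(\<lambda>l. h (k - l) * u l) summable_on UNIV"
    by (rule summable_on_comparison_test[OF summable_on_cmult_left[OF hk, of B]])
      (use h u in \<open>auto intro!: mult_left_mono mult_nonneg_nonneg\<close>)
  show s2: "(\<lambda>l. h (k - l) * (u l)\<^sup>2) summable_on UNIV"
    by (rule summable_on_comparison_test[OF summable_on_cmult_left[OF hk, of "B\<^sup>2"]])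
      (use h u in \<open>auto intro!: mult_left_mono mult_nonneg_nonneg power_mono\<close>)
  define S where "S = (\<Sum>\<^sub>\<infinity>l. h (k - l) * u l)"
  define P where "P = (\<Sum>\<^sub>\<infinity>l. h (k - l) * (u l)\<^sup>2)"
  \<comment> \<open>This value minimises \<open>P - 2 * t * S + t^2 * H\<close>, where the mass of
    \<open>h\<close> is replaced by its upper bound \<open>H\<close>.\<close>
  define t where "t = S / H"
  have "0 \<le> (\<Sum>\<^sub>\<infinity>l. h (k - l) * (u l - t)\<^sup>2)"
    by (intro infsum_nonneg mult_nonneg_nonneg h) auto
  also have "\<dots> = (\<Sum>\<^sub>\<infinity>l. (h (k - l) * (u l)\<^sup>2 + (- 2 * t) * (h (k - l) * u l)) + t\<^sup>2 * h (k - l))"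
    by (intro infsum_cong) (simp add: power2_eq_square algebra_simps)
  also have "\<dots> = P + (- 2 * t) * S + t\<^sup>2 * (\<Sum>\<^sub>\<infinity>l. h (k - l))"
    unfolding S_def P_def
    by (subst infsum_add; (subst infsum_add)?)
      (auto intro!: summable_on_add summable_on_cmult_right s1 s2 hk simp: infsum_cmult_right' simp del: mult_minus_left)
  also have "\<dots> \<le> P + (- 2 * t) * S + t\<^sup>2 * H"
    using hk_sum by (intro add_left_mono mult_left_mono) auto
  also have "\<dots> = P - S\<^sup>2 / H"
    using h(4) by (simp add: t_def power2_eq_square field_simps)
  finally show "S\<^sup>2 \<le> H * P" using h(4) by (simp add: field_simps)
qed

text \<open>Young's inequality for a summable kernel and a square summable sequence: Cauchy-Schwarz
  with weight \<open>h\<close> bounds each squared coordinate by one factor \<open>H\<close>, and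
  summation over \<open>k\<close> costs a second one.\<close>

lemma ell2_convolution:
  fixes h :: "int \<Rightarrow> real"
  assumes h: "h summable_on UNIV" "\<And>j. h j \<ge> 0" "(\<Sum>\<^sub>\<infinity>j. h j) \<le> H" "H > 0"
    and u: "u \<in> ell2"
    and e: "\<And>k. cmod (e k) \<le> (\<Sum>\<^sub>\<infinity>l. h (k - l) * cmod (u l))"
  shows "e \<in> ell2" "(ell2_norm e)\<^sup>2 \<le> H\<^sup>2 * (ell2_norm u)\<^sup>2"
proof -
  have ub: "cmod (u l) \<le> \<bar>ell2_norm u\<bar>" for l
    using ell2_coord_le[OF u, of l] by (metis abs_le_square_iff abs_norm_cancel)
  note cs = convolution_cauchy_schwarz[OF h, of "\<lambda>l. cmod (u l)", OF norm_ge_zero ub]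
  have us: "(\<lambda>l. (cmod (u l))\<^sup>2) summable_on UNIV" using u by (simp add: ell2_def)
  \<comment> \<open>Over a finite set \<open>F\<close> the exchange of sums is mere additivity. A
    bound uniform in \<open>F\<close> then gives both membership in \<open>ell2\<close> and the norm
    estimate.\<close>
  have fin: "(\<Sum>k\<in>F. (cmod (e k))\<^sup>2) \<le> H\<^sup>2 * (ell2_norm u)\<^sup>2" if F: "finite F" for F
  proof -
    have hF: "(\<Sum>k\<in>F. h (k - l)) \<le> H" for l
    proof -
      have "(\<Sum>k\<in>F. h (k - l)) = sum h ((\<lambda>k. k - l) ` F)"
        by (subst sum.reindex) (auto simp: inj_on_def)
      also have "\<dots> \<le> (\<Sum>\<^sub>\<infinity>j. h j)"
        using F h by (intro finite_sum_le_infsum) auto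
      finally show ?thesis using h(3) by simp
    qed
    have "(\<Sum>k\<in>F. (cmod (e k))\<^sup>2) \<le> (\<Sum>k\<in>F. H * (\<Sum>\<^sub>\<infinity>l. h (k - l) * (cmod (u l))\<^sup>2))"
    proof (rule sum_mono)
      fix k
      have "(cmod (e k))\<^sup>2 \<le> (\<Sum>\<^sub>\<infinity>l. h (k - l) * cmod (u l))\<^sup>2"
        by (intro power_mono e) auto
      then show "(cmod (e k))\<^sup>2 \<le> H * (\<Sum>\<^sub>\<infinity>l. h (k - l) * (cmod (u l))\<^sup>2)"
        using cs(1)[of k] by linarith
    qed
    also have "\<dots> = H * (\<Sum>\<^sub>\<infinity>l. \<Sum>k\<in>F. h (k - l) * (cmod (u l))\<^sup>2)"
      unfolding sum_distrib_left[symmetric]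
      by (subst infsumI[OF has_sum_sum[OF has_sum_infsum]]) (auto intro: cs)
    also have "\<dots> \<le> H * (\<Sum>\<^sub>\<infinity>l. H * (cmod (u l))\<^sup>2)"
    proof (intro mult_left_mono infsum_mono)
      show "(\<lambda>l. \<Sum>k\<in>F. h (k - l) * (cmod (u l))\<^sup>2) summable_on UNIV"
        using has_sum_imp_summable[OF has_sum_sum[OF has_sum_infsum[OF cs(3)]]] .
      show "(\<lambda>l. H * (cmod (u l))\<^sup>2) summable_on UNIV" by (intro summable_on_cmult_right us)
      show "(\<Sum>k\<in>F. h (k - l) * (cmod (u l))\<^sup>2) \<le> H * (cmod (u l))\<^sup>2" for l
        unfolding sum_distrib_right[symmetric] by (intro mult_right_mono hF) auto
    qed (use h in auto)
    also have "\<dots> = H\<^sup>2 * (ell2_norm u)\<^sup>2"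
      by (simp only: ell2_norm_power2 infsum_cmult_right' power2_eq_square[of H] mult.assoc)
    finally show ?thesis .
  qed
  have "(\<lambda>k. (cmod (e k))\<^sup>2) summable_on UNIV"
    by (rule nonneg_bdd_above_summable_on) (auto intro!: bdd_aboveI2[where M = "H\<^sup>2 * (ell2_norm u)\<^sup>2"] fin)
  then show "e \<in> ell2" by (simp add: ell2_def)
  show "(ell2_norm e)\<^sup>2 \<le> H\<^sup>2 * (ell2_norm u)\<^sup>2"
    unfolding ell2_norm_power2[of e]
    by (rule infsum_le_finite_sums) (auto intro: fin \<open>(\<lambda>k. (cmod (e k))\<^sup>2) summable_on UNIV\<close>)
qed

section \<open>Localised lower bounds for Toeplitz operators\<close>

text \<open>Here \<open>w\<close> is bounded and need not lie in \<open>ell2\<close>, so that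
  \<open>bi_apply (toeplitz a)\<close> is a convergent sum on periodic sequences as well.\<close>

lemma toeplitz_row_abs_summable:
  fixes a w :: "int \<Rightarrow> complex"
  assumes decay: "\<And>k. cmod (a k) \<le> C * exp (- \<gamma> * real_of_int \<bar>k\<bar>)" and "\<gamma> > 0"
    and bdd: "\<And>l. cmod (w l) \<le> B"
  shows "(\<lambda>l. cmod (a (k - l) * w l)) summable_on UNIV"
proof (rule abs_summable_on_comparison_test')
  have C: "C \<ge> 0" using order.trans[OF norm_ge_zero decay[of 0]] by simp
  show "(\<lambda>l. C * B * exp (- \<gamma> * real_of_int \<bar>l - k\<bar>)) summable_on UNIV"
    using assms by (intro summable_on_cmult_right exp_neg_abs_summable)
  show "cmod (a (k - l) * w l) \<le> C * B * exp (- \<gamma> * real_of_int \<bar>l - k\<bar>)" for l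
  proof -
    have "cmod (a (k - l)) * cmod (w l) \<le> (C * exp (- \<gamma> * real_of_int \<bar>k - l\<bar>)) * B"
      using C by (intro mult_mono decay bdd) auto
    then show ?thesis by (simp add: norm_mult abs_minus_commute mult_ac)
  qed
qed

text \<open>For r < 0 this is 2 \<le> exp r + exp (- r); otherwise it is an equality.\<close>

lemma abs_one_minus_exp_le: "\<bar>1 - exp r\<bar> \<le> exp \<bar>r\<bar> - 1" for r :: real
proof (cases "r \<ge> 0")
  case False
  have "2 * 1 \<le> exp r + exp (- r)"
    using exp_ge_add_one_self[of r] exp_ge_add_one_self[of "- r"] by linarith
  then show ?thesis using False by simp
qed simp

text \<open>The factor \<open>t\<close> on the right is what makes the commutator small. In exp (t
  j) - 1 \<le> t j exp (t j), the factors j and exp (t j) cost a quarter of the decay rate each, and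
  half of it is left for summation.\<close>

lemma exp_commutator_bound:
  fixes t \<gamma> :: real
  assumes "0 \<le> t" "t \<le> \<gamma> / 4" "\<gamma> > 0" "\<bar>s\<bar> \<le> j"
  shows "exp (- \<gamma> * j) * \<bar>1 - exp (t * s)\<bar> \<le> t * (4 / \<gamma>) * exp (- (\<gamma> / 2) * j)"
proof -
  have j: "0 \<le> j" using assms by linarith
  have "\<bar>1 - exp (t * s)\<bar> \<le> exp (t * j) - 1"
  proof -
    have "\<bar>t * s\<bar> \<le> t * j" using assms by (simp add: abs_mult mult_left_mono)
    then show ?thesis using abs_one_minus_exp_le[of "t * s"] by (smt (verit) exp_le_cancel_iff)
  qed
  also have "\<dots> \<le> t * j * exp (t * j)"
  proof -
    have "1 - t * j \<le> exp (- (t * j))" using exp_ge_add_one_self[of "- (t * j)"] by simp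
    then have "(1 - t * j) * exp (t * j) \<le> exp (- (t * j)) * exp (t * j)"
      by (rule mult_right_mono) simp
    then show ?thesis by (simp add: algebra_simps exp_add[symmetric])
  qed
  also have "\<dots> \<le> t * ((4 / \<gamma>) * exp (\<gamma> / 4 * j)) * exp (\<gamma> / 4 * j)"
  proof (intro mult_mono mult_nonneg_nonneg)
    have "\<gamma> / 4 * j \<le> exp (\<gamma> / 4 * j)" using exp_ge_add_one_self[of "\<gamma> / 4 * j"] by linarith
    then show "j \<le> 4 / \<gamma> * exp (\<gamma> / 4 * j)" using assms by (simp add: field_simps)
    show "exp (t * j) \<le> exp (\<gamma> / 4 * j)"
      using mult_right_mono[OF assms(2) j] by simp
  qed (use assms j in auto)
  also have "\<dots> = t * (4 / \<gamma>) * exp (\<gamma> / 2 * j)"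
    by (simp add: exp_add[symmetric])
  finally have "exp (- \<gamma> * j) * \<bar>1 - exp (t * s)\<bar> \<le> exp (- \<gamma> * j) * (t * (4 / \<gamma>) * exp (\<gamma> / 2 * j))"
    by (intro mult_left_mono) auto
  also have "\<dots> = t * (4 / \<gamma>) * (exp (- \<gamma> * j) * exp (\<gamma> / 2 * j))" by simp
  also have "exp (- \<gamma> * j) * exp (\<gamma> / 2 * j) = exp (- (\<gamma> / 2) * j)"
    by (simp add: exp_add[symmetric])
  finally show ?thesis .
qed

text \<open>Multiplication by $e^{-2\varepsilon|l-k_0|}$ commutes with the operator up to a small
  perturbation, so the $\ell^2$ lower bound survives in the weighted space.  The weight turns
  bounded sequences into square summable ones and localises the estimate at $k_0$.\<close>

lemma toeplitz_local_bound:
  fixes a :: "int \<Rightarrow> complex" and \<gamma> C K :: real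
  assumes decay: "\<And>k. cmod (a k) \<le> C * exp (- \<gamma> * real_of_int \<bar>k\<bar>)" and "\<gamma> > 0" "C > 0" "K > 0"
    and below: "\<And>u. u \<in> ell2 \<Longrightarrow> ell2_norm u \<le> K * ell2_norm (bi_apply (toeplitz a) u)"
  obtains \<epsilon> K' where "\<epsilon> > 0" "2 * \<epsilon> < \<gamma>" "K' > 0"
    "\<And>w B k0 M. (\<And>l. cmod (w l) \<le> B) \<Longrightarrow>
       (\<And>l. cmod (bi_apply (toeplitz a) w l) \<le> M * exp (\<epsilon> * real_of_int \<bar>l - k0\<bar>)) \<Longrightarrow>
       cmod (w k0) \<le> K' * M"
proof -
  define A where "A = (\<Sum>\<^sub>\<infinity>j::int. exp (- (\<gamma> / 2) * real_of_int \<bar>j\<bar>))"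
  have sumA: "(\<lambda>j::int. exp (- (\<gamma> / 2) * real_of_int \<bar>j\<bar>)) summable_on UNIV"
    using exp_neg_abs_summable[of "\<gamma> / 2" 0] \<open>\<gamma> > 0\<close> by simp
  have A: "A \<ge> 1"
    using finite_sum_le_infsum[OF sumA, of "{0}"] by (simp add: A_def)
  \<comment> \<open>A perturbation of norm at most \<open>H\<close> contributes
    \<open>2 * K^2 * H^2 = 1 / 2\<close> times the squared norm of \<open>u\<close>, which can be
    absorbed.\<close>
  define H where "H = 1 / (2 * K)"
  \<comment> \<open>The first entry of the minimum admits \<open>exp_commutator_bound\<close>; the
    second brings the sum of \<open>h\<close> below \<open>H\<close>.\<close>
  define t where "t = min (\<gamma> / 4) (H * \<gamma> / (4 * C * A))"
  define h where "h = (\<lambda>j::int. t * (4 / \<gamma>) * C * exp (- (\<gamma> / 2) * real_of_int \<bar>j\<bar>))"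
  have H: "H > 0" using \<open>K > 0\<close> by (simp add: H_def)
  have t: "t > 0" "t \<le> \<gamma> / 4" "t \<le> H * \<gamma> / (4 * C * A)"
    using assms A H by (auto simp: t_def)
  have h_summable: "h summable_on UNIV"
    unfolding h_def by (intro summable_on_cmult_right sumA)
  have h_nonneg: "h j \<ge> 0" for j using t assms by (simp add: h_def)
  have h_sum: "(\<Sum>\<^sub>\<infinity>j. h j) \<le> H"
  proof -
    have "(\<Sum>\<^sub>\<infinity>j. h j) = t * (4 / \<gamma>) * C * A"
      unfolding h_def A_def by (rule infsum_cmult_right')
    also have "\<dots> \<le> H * \<gamma> / (4 * C * A) * (4 / \<gamma>) * C * A"
      using t assms A by (intro mult_right_mono) auto
    also have "\<dots> = H" using assms A by simp
    finally show ?thesis .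
  qed
  define D where "D = (\<Sum>\<^sub>\<infinity>j::int. exp (- t * real_of_int \<bar>j\<bar>))"
  have D: "D \<ge> 0" unfolding D_def by (intro infsum_nonneg) auto
  \<comment> \<open>The square root undoes the final inequality between squares; the summand 1 makes
    \<open>K'\<close> positive.\<close>
  define K' where "K' = sqrt (4 * K\<^sup>2 * D) + 1"
  \<comment> \<open>The growth rate \<open>t / 2\<close> is half the rate of the weight, so the
    weighted right-hand side still decays and its squares sum to at most
    \<open>M^2 * D\<close>.\<close>
  have "cmod (w k0) \<le> K' * M"
    if bdd: "\<And>l. cmod (w l) \<le> B"
      and Lw: "\<And>l. cmod (bi_apply (toeplitz a) w l) \<le> M * exp (t / 2 * real_of_int \<bar>l - k0\<bar>)"
    for w B k0 M
  proof -
    let ?L = "bi_apply (toeplitz a)"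
    define \<phi> where "\<phi> = (\<lambda>k. exp (- t * real_of_int \<bar>k - k0\<bar>))"
    define u where "u = (\<lambda>k. of_real (\<phi> k) * w k)"
    define e where "e = (\<lambda>k. ?L u k - of_real (\<phi> k) * ?L w k)"
    have phi_pos: "\<phi> k > 0" and phi_le: "\<phi> k \<le> 1" for k using t by (auto simp: \<phi>_def)
    have B: "B \<ge> 0" using order.trans[OF norm_ge_zero bdd[of 0]] .
    have M: "M \<ge> 0" using order.trans[OF norm_ge_zero Lw[of k0]] by simp
    have u_le: "cmod (u k) \<le> B" for k
    proof -
      have "\<phi> k * cmod (w k) \<le> 1 * B"
        using phi_le bdd phi_pos B by (intro mult_mono) (auto intro: less_imp_le)
      then show ?thesis using phi_pos[of k] by (simp add: u_def norm_mult)
    qed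
    have phi2: "(\<phi> k)\<^sup>2 = exp (- (2 * t) * real_of_int \<bar>k - k0\<bar>)" for k
      by (simp add: \<phi>_def power2_eq_square exp_add[symmetric])
    \<comment> \<open>The bound \<open>B\<close> secures convergence and membership in
      \<open>ell2\<close>, but does not enter \<open>K'\<close>.\<close>
    have u: "u \<in> ell2"
    proof (rule ell2_comparison(1))
      show "(\<lambda>k. B\<^sup>2 * exp (- (2 * t) * real_of_int \<bar>k - k0\<bar>)) summable_on UNIV"
        using t by (intro summable_on_cmult_right exp_neg_abs_summable) auto
      show "(cmod (u k))\<^sup>2 \<le> B\<^sup>2 * exp (- (2 * t) * real_of_int \<bar>k - k0\<bar>)" for k
        unfolding phi2[symmetric] using power_mono[OF bdd norm_ge_zero, of k 2] phi_pos[of k]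
        by (simp add: u_def norm_mult power_mult_distrib mult.commute mult_left_mono)
    qed
    note sm = toeplitz_row_abs_summable[OF decay \<open>\<gamma> > 0\<close>]
    have e: "cmod (e k) \<le> (\<Sum>\<^sub>\<infinity>l. h (k - l) * cmod (u l))" for k
    proof -
      have su: "(\<lambda>l. a (k - l) * u l) summable_on UNIV"
        by (rule abs_summable_summable[OF sm[OF u_le]])
      have sw: "(\<lambda>l. of_real (\<phi> k) * (a (k - l) * w l)) summable_on UNIV"
        by (intro summable_on_cmult_right abs_summable_summable[OF sm[OF bdd]])
      have "((\<lambda>l. a (k - l) * u l - of_real (\<phi> k) * (a (k - l) * w l)) has_sum e k) UNIV"
        unfolding e_def bi_apply_def toeplitz_def
        using has_sum_add[OF has_sum_infsum[OF su] has_sum_uminusI[OF has_sum_infsum[OF sw]]]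
        by (simp add: infsum_cmult_right')
      moreover have "((\<lambda>l. h (k - l) * cmod (u l)) has_sum (\<Sum>\<^sub>\<infinity>l. h (k - l) * cmod (u l))) UNIV"
        by (intro has_sum_infsum
            convolution_cauchy_schwarz(2)[OF h_summable h_nonneg h_sum H norm_ge_zero u_le])
      ultimately show ?thesis
      proof (rule norm_infsum_le)
        fix l :: int
        \<comment> \<open>Substituting w = u / \<phi> turns \<open>e\<close> into the kernel
          \<open>a (k - l) * (1 - \<phi> k / \<phi> l)\<close> applied to \<open>u\<close>.\<close>
        have "of_real (\<phi> k) = complex_of_real (\<phi> l) * of_real (\<phi> k / \<phi> l)"
          using phi_pos[of l] by simp
        moreover have "\<phi> l \<noteq> 0" using phi_pos[of l] by simp
        ultimately have "a (k - l) * u l - of_real (\<phi> k) * (a (k - l) * w l)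
            = a (k - l) * u l * of_real (1 - \<phi> k / \<phi> l)"
          by (simp add: u_def field_simps)
        then have "cmod (a (k - l) * u l - of_real (\<phi> k) * (a (k - l) * w l))
            = cmod (a (k - l)) * \<bar>1 - \<phi> k / \<phi> l\<bar> * cmod (u l)"
          by (simp only: norm_mult norm_of_real mult_ac)
        also have "\<dots> \<le> h (k - l) * cmod (u l)"
        proof (rule mult_right_mono)
          \<comment> \<open>By the reverse triangle inequality the difference of distances is at
            most |k - l|, so the bound on the kernel does not depend on \<open>k0\<close>.\<close>
          have eq: "\<phi> k / \<phi> l = exp (t * real_of_int (\<bar>l - k0\<bar> - \<bar>k - k0\<bar>))"
            by (simp add: \<phi>_def exp_diff[symmetric] algebra_simps)
          have "cmod (a (k - l)) * \<bar>1 - \<phi> k / \<phi> l\<bar>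
              \<le> C * exp (- \<gamma> * real_of_int \<bar>k - l\<bar>) * \<bar>1 - \<phi> k / \<phi> l\<bar>"
            by (intro mult_right_mono decay) auto
          also have "\<dots> \<le> C * (t * (4 / \<gamma>) * exp (- (\<gamma> / 2) * real_of_int \<bar>k - l\<bar>))"
            unfolding eq mult.assoc[of C] using t assms
            by (intro mult_left_mono exp_commutator_bound) auto
          finally show "cmod (a (k - l)) * \<bar>1 - \<phi> k / \<phi> l\<bar> \<le> h (k - l)"
            by (simp add: h_def mult_ac)
        qed simp
        finally show "cmod (a (k - l) * u l - of_real (\<phi> k) * (a (k - l) * w l))
            \<le> h (k - l) * cmod (u l)" .
      qed
    qed
    note conv = ell2_convolution[OF h_summable h_nonneg h_sum H u e]
    define v where "v = (\<lambda>k. of_real (\<phi> k) * ?L w k)"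
    have v_le: "(cmod (v k))\<^sup>2 \<le> M\<^sup>2 * exp (- t * real_of_int \<bar>k - k0\<bar>)" for k
    proof -
      have "(cmod (v k))\<^sup>2 = (\<phi> k)\<^sup>2 * (cmod (?L w k))\<^sup>2"
        using phi_pos[of k] by (simp add: v_def norm_mult power_mult_distrib)
      also have "\<dots> \<le> (\<phi> k)\<^sup>2 * (M * exp (t / 2 * real_of_int \<bar>k - k0\<bar>))\<^sup>2"
        by (intro mult_left_mono power_mono Lw) auto
      also have "\<dots> = M\<^sup>2 * (exp (- (2 * t) * real_of_int \<bar>k - k0\<bar>)
          * (exp (t / 2 * real_of_int \<bar>k - k0\<bar>))\<^sup>2)"
        unfolding phi2 by (simp add: power_mult_distrib)
      also have "exp (- (2 * t) * real_of_int \<bar>k - k0\<bar>) * (exp (t / 2 * real_of_int \<bar>k - k0\<bar>))\<^sup>2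
          = exp (- t * real_of_int \<bar>k - k0\<bar>)"
        by (simp add: power2_eq_square exp_add[symmetric])
      finally show ?thesis .
    qed
    have v_sum: "(\<lambda>k. M\<^sup>2 * exp (- t * real_of_int \<bar>k - k0\<bar>)) summable_on UNIV"
      using t by (intro summable_on_cmult_right exp_neg_abs_summable)
    note v = ell2_comparison[OF v_sum v_le]
    have v_norm: "(ell2_norm v)\<^sup>2 \<le> M\<^sup>2 * D"
      using v(2) unfolding infsum_cmult_right' D_def
      using infsum_exp_neg_abs_shift[of t k0] by simp
    have Lu: "?L u = (\<lambda>k. v k + e k)" by (auto simp: v_def e_def)
    have "ell2_norm u \<ge> 0" "ell2_norm (?L u) \<ge> 0"
      by (simp_all add: ell2_norm_def infsum_nonneg)
    then have "(ell2_norm u)\<^sup>2 \<le> K\<^sup>2 * (ell2_norm (?L u))\<^sup>2"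
      using power_mono[OF below[OF u], of 2] by (simp add: power_mult_distrib)
    also have "\<dots> \<le> K\<^sup>2 * (2 * (ell2_norm v)\<^sup>2 + 2 * (ell2_norm e)\<^sup>2)"
      unfolding Lu by (intro mult_left_mono ell2_add v conv) auto
    also have "\<dots> \<le> K\<^sup>2 * (2 * (M\<^sup>2 * D) + 2 * (H\<^sup>2 * (ell2_norm u)\<^sup>2))"
      using v_norm conv(2) by (intro mult_left_mono add_mono) auto
    also have "\<dots> = 2 * K\<^sup>2 * D * M\<^sup>2 + (ell2_norm u)\<^sup>2 / 2"
      using \<open>K > 0\<close> by (simp add: H_def field_simps power2_eq_square)
    \<comment> \<open>Half of the squared norm of \<open>u\<close> moves to the left, which doubles
      the constant.\<close>
    finally have "(ell2_norm u)\<^sup>2 \<le> (4 * K\<^sup>2 * D) * M\<^sup>2" by simp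
    moreover have "u k0 = w k0" by (simp add: u_def \<phi>_def)
    ultimately have "(cmod (w k0))\<^sup>2 \<le> (4 * K\<^sup>2 * D) * M\<^sup>2"
      using ell2_coord_le[OF u, of k0] by simp
    then have "cmod (w k0) \<le> sqrt ((4 * K\<^sup>2 * D) * M\<^sup>2)"
      by (rule real_le_rsqrt)
    also have "\<dots> = sqrt (4 * K\<^sup>2 * D) * M" using M by (simp add: real_sqrt_mult)
    also have "\<dots> \<le> K' * M" using M by (simp add: K'_def distrib_right)
    finally show ?thesis .
  qed
  moreover have "K' > 0" using D by (simp add: K'_def add_nonneg_pos)
  moreover have "2 * (t / 2) < \<gamma>" "t / 2 > 0" using t \<open>\<gamma> > 0\<close> by auto
  ultimately show thesis using that by blast
qed

text \<open>Apply the bound of the inverse \<open>R\<close> to u = R (T u). That bound carries no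
  sign, hence the positive constant |K| + 1.\<close>

lemma boundedly_invertible_bounded_below:
  assumes "ell2_bounded_op T" "ell2_boundedly_invertible T"
  obtains K where "K > 0" "\<And>u. u \<in> ell2 \<Longrightarrow> ell2_norm u \<le> K * ell2_norm (T u)"
proof -
  obtain R where R: "ell2_bounded_op R" "\<forall>x\<in>ell2. R (T x) = x \<and> T (R x) = x"
    using assms(2) unfolding ell2_boundedly_invertible_def by blast
  then obtain K where K: "\<forall>x\<in>ell2. ell2_norm (R x) \<le> K * ell2_norm x"
    unfolding ell2_bounded_op_def by blast
  have "ell2_norm u \<le> (\<bar>K\<bar> + 1) * ell2_norm (T u)" if u: "u \<in> ell2" for u
  proof -
    have "T u \<in> ell2" using assms(1) u unfolding ell2_bounded_op_def by blast
    then have "ell2_norm u \<le> K * ell2_norm (T u)" using K R(2) u by metis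
    also have "\<dots> \<le> (\<bar>K\<bar> + 1) * ell2_norm (T u)"
      by (intro mult_right_mono) (auto simp: ell2_norm_def infsum_nonneg)
    finally show ?thesis .
  qed
  then show thesis using that[of "\<bar>K\<bar> + 1"] by simp
qed

section \<open>Hermitian positive definite sections and the Schur complement\<close>

text \<open>Self-adjointness tested on two unit vectors reads off single entries.\<close>

lemma bi_hermitian_pos_def_adjoint:
  assumes "bi_hermitian_pos_def A"
  shows "A k l = cnj (A l k)"
proof -
  define e where "e = (\<lambda>(i::int) k. if k = i then 1 else (0::complex))"
  have e: "e i \<in> ell2" for i by (rule ell2_finite_support) (simp add: e_def)
  have single: "(\<Sum>\<^sub>\<infinity>l. g l) = g i" if "\<And>l. l \<noteq> i \<Longrightarrow> g l = 0" for g :: "int \<Rightarrow> complex" and i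
    using infsum_cong_neutral[of "{i}" UNIV g g] that by auto
  have ap: "bi_apply A (e i) = (\<lambda>k. A k i)" for i
    unfolding bi_apply_def by (subst single) (auto simp: e_def)
  have "ell2_inner (bi_apply A (e l)) (e k) = ell2_inner (e l) (bi_apply A (e k))"
    using assms e unfolding bi_hermitian_pos_def_def by blast
  moreover have "ell2_inner (bi_apply A (e l)) (e k) = A k l"
    unfolding ap ell2_inner_def by (subst single[of k]) (auto simp: e_def)
  moreover have "ell2_inner (e l) (bi_apply A (e k)) = cnj (A l k)"
    unfolding ap ell2_inner_def by (subst single[of l]) (auto simp: e_def)
  ultimately show ?thesis by simp
qed

text \<open>Testing positivity on $u - tAu$ for small $t > 0$ shows that a zero of the quadratic form
  is a zero of the operator.\<close>

lemma bi_hermitian_pos_def_kernel: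
  assumes A: "bi_hermitian_pos_def A" and u: "u \<in> ell2"
    and zero: "ell2_inner (bi_apply A u) u = 0"
  shows "bi_apply A u k = 0"
proof -
  let ?T = "bi_apply A"
  define v where "v = ?T u"
  have op: "ell2_bounded_op ?T"
    and sym: "\<And>x y. x \<in> ell2 \<Longrightarrow> y \<in> ell2 \<Longrightarrow> ell2_inner (?T x) y = ell2_inner x (?T y)"
    and pos: "\<And>x. x \<in> ell2 \<Longrightarrow> 0 \<le> Re (ell2_inner (?T x) x)"
    using A unfolding bi_hermitian_pos_def_def bi_bounded_def by auto
  have T: "?T x \<in> ell2" if "x \<in> ell2" for x using op that unfolding ell2_bounded_op_def by blast
  have lin: "?T (\<lambda>k. x k + y k) = (\<lambda>k. ?T x k + ?T y k)" if "x \<in> ell2" "y \<in> ell2" for x y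
    using op that unfolding ell2_bounded_op_def by simp
  have v: "v \<in> ell2" using T u by (simp add: v_def)
  define c where "c = Re (ell2_inner (?T v) v)"
  define q where "q = (ell2_norm v)\<^sup>2"
  have c: "c \<ge> 0" using pos[OF v] by (simp add: c_def)
  \<comment> \<open>This is the quadratic form at \<open>u - t * v\<close>: its constant term is the
    assumed zero, and self-adjointness turns each mixed term into \<open>- t * q\<close>.\<close>
  have quad: "0 \<le> - 2 * t * q + t\<^sup>2 * c" for t :: real
  proof -
    define d where "d = - complex_of_real t"
    have dv: "(\<lambda>k. d * v k) \<in> ell2" by (rule ell2_cmult[OF v])
    have p: "(\<lambda>k. u k + d * v k) \<in> ell2" by (rule ell2_add(1)[OF u dv])
    have "?T (\<lambda>k. u k + d * v k) = (\<lambda>k. ?T u k + ?T (\<lambda>k. d * v k) k)"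
      by (rule lin[OF u dv])
    also have "?T (\<lambda>k. d * v k) = (\<lambda>k. d * ?T v k)"
      using op v unfolding ell2_bounded_op_def by simp
    finally have Tp: "?T (\<lambda>k. u k + d * v k) = (\<lambda>k. v k + d * ?T v k)" by (simp add: v_def)
    have "ell2_inner (?T (\<lambda>k. u k + d * v k)) (\<lambda>k. u k + d * v k)
        = ell2_inner v u + cnj d * ell2_inner v v
          + d * (ell2_inner (?T v) u + cnj d * ell2_inner (?T v) v)"
      unfolding Tp using p u v T[OF v]
      by (simp add: ell2_inner_add_left ell2_inner_add_right algebra_simps)
    also have "ell2_inner (?T v) u = ell2_inner v v" using sym[OF v u] by (simp add: v_def)
    also have "ell2_inner v u = 0" using zero by (simp add: v_def)
    finally have "0 \<le> Re (0 + cnj d * ell2_inner v v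
          + d * (ell2_inner v v + cnj d * ell2_inner (?T v) v))"
      using pos[OF p] by simp
    also have "\<dots> = - 2 * t * q + t\<^sup>2 * c"
      unfolding ell2_inner_self[OF v] by (simp add: d_def c_def q_def power2_eq_square right_diff_distrib)
    finally show ?thesis .
  qed
  have "q = 0"
  proof (rule ccontr)
    assume "q \<noteq> 0"
    then have q: "q > 0" by (simp add: q_def)
    \<comment> \<open>The denominator \<open>c + 1\<close> covers \<open>c = 0\<close>; at this
      \<open>t\<close> the quadratic is at most \<open>- q^2 / (c + 1)\<close>.\<close>
    have "0 \<le> - 2 * (q / (c + 1)) * q + (q / (c + 1))\<^sup>2 * c" by (rule quad)
    also have "\<dots> \<le> - 2 * (q / (c + 1)) * q + (q / (c + 1))\<^sup>2 * (c + 1)"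
      by (intro add_left_mono mult_left_mono) auto
    also have "(q / (c + 1))\<^sup>2 * (c + 1) = q * q / (c + 1)"
      using c by (simp add: power2_eq_square)
    also have "- 2 * (q / (c + 1)) * q + q * q / (c + 1) = - (q * q / (c + 1))"
      by simp
    finally have "q * q / (c + 1) \<le> 0" by simp
    moreover have "q * q / (c + 1) > 0" using q c by simp
    ultimately show False by simp
  qed
  then show ?thesis using ell2_norm_eq_0[OF v] by (simp add: q_def v_def)
qed

lemma extend_by_zero_nth:
  assumes "i < 2 * n - 1"
  shows "extend_by_zero n z (int i - int n + 1) = z $ i"
  using assms by (auto simp: extend_by_zero_def)

lemma extend_by_zero_outside: "\<bar>k\<bar> \<ge> int n \<Longrightarrow> extend_by_zero n z k = 0"
  by (auto simp: extend_by_zero_def)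

text \<open>Extend \<open>p\<close> by zero to \<open>u\<close>. The image of \<open>u\<close>
  vanishes on the section and \<open>u\<close> vanishes off it, so the quadratic form is zero at
  \<open>u\<close>; then the image vanishes everywhere and invertibility of the full operator gives
  u = 0.\<close>

lemma mat_section_injective:
  assumes A: "bi_hermitian_pos_def A" and p: "p \<in> carrier_vec (2 * n - 1)"
    and zero: "mat_section A n *\<^sub>v p = 0\<^sub>v (2 * n - 1)"
  shows "p = 0\<^sub>v (2 * n - 1)"
proof -
  define u where "u = extend_by_zero n p"
  define I where "I = (\<lambda>i. int i - int n + 1) ` {..<2 * n - 1}"
  have out: "u k = 0" if "k \<notin> I" for k
  proof (cases "\<bar>k\<bar> \<ge> int n")
    case True
    then show ?thesis by (simp add: u_def extend_by_zero_outside)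
  next
    case False
    then have "k = int (nat (k + int n - 1)) - int n + 1" "nat (k + int n - 1) < 2 * n - 1" by auto
    then have "k \<in> I" unfolding I_def by blast
    with that show ?thesis by simp
  qed
  have u: "u \<in> ell2"
    by (rule ell2_finite_support, rule finite_subset[of _ I]) (use out in \<open>auto simp: I_def\<close>)
  have in0: "bi_apply A u k = 0" if "k \<in> I" for k
  proof -
    obtain i where i: "i < 2 * n - 1" "k = int i - int n + 1"
      using \<open>k \<in> I\<close> unfolding I_def by blast
    have "bi_apply A u k = (\<Sum>\<^sub>\<infinity>l\<in>I. A k l * u l)"
      unfolding bi_apply_def by (rule infsum_cong_neutral) (auto simp: out)
    also have "\<dots> = (\<Sum>l\<in>I. A k l * u l)" by (simp add: I_def)
    also have "\<dots> = (\<Sum>j<2 * n - 1. A k (int j - int n + 1) * p $ j)"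
      unfolding I_def by (subst sum.reindex) (auto simp: inj_on_def u_def extend_by_zero_nth)
    also have "\<dots> = (mat_section A n *\<^sub>v p) $ i"
      using i p by (simp add: mat_section_def scalar_prod_def lessThan_atLeast0)
    finally show ?thesis using zero i by simp
  qed
  have "ell2_inner (bi_apply A u) u = 0"
  proof -
    have "bi_apply A u k * cnj (u k) = 0" for k using in0 out by (cases "k \<in> I") auto
    then show ?thesis unfolding ell2_inner_def by (intro infsum_0) blast
  qed
  then have Tu: "bi_apply A u k = 0" for k by (rule bi_hermitian_pos_def_kernel[OF A u])
  obtain R where R: "\<forall>x\<in>ell2. R (bi_apply A x) = x \<and> bi_apply A (R x) = x"
    using A unfolding bi_hermitian_pos_def_def ell2_boundedly_invertible_def by blast
  have "bi_apply A u = bi_apply A (\<lambda>_. 0)" using Tu by (auto simp: bi_apply_def fun_eq_iff)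
  moreover have "(\<lambda>_. 0) \<in> ell2" by (rule ell2_finite_support) simp
  ultimately have "u = (\<lambda>_. 0)" using R u by metis
  then show ?thesis
    using p extend_by_zero_nth[of _ n p] by (intro eq_vecI) (auto simp: u_def fun_eq_iff)
qed

lemma injective_mat_imp_det_nonzero:
  fixes A :: "'a::field mat"
  assumes "A \<in> carrier_mat n n"
    and "\<And>v. v \<in> carrier_vec n \<Longrightarrow> A *\<^sub>v v = 0\<^sub>v n \<Longrightarrow> v = 0\<^sub>v n"
  shows "det A \<noteq> 0"
  using assms(2) unfolding det_0_iff_vec_prod_zero_field[OF assms(1)] by blast

lemma det_nonzero_mat_inverse:
  fixes A :: "'a::field mat"
  assumes A: "A \<in> carrier_mat n n" and "det A \<noteq> 0"
  obtains B where "mat_inverse A = Some B" "B \<in> carrier_mat n n" "A * B = 1\<^sub>m n" "B * A = 1\<^sub>m n"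
proof -
  have "A \<in> Units (ring_mat TYPE('a) n ())" by (rule det_non_zero_imp_unit[OF assms])
  then obtain B where B: "mat_inverse A = Some B"
    using mat_inverse(1)[OF A, of "()"] by (cases "mat_inverse A") auto
  then show thesis using mat_inverse(2)[OF A B] that by blast
qed

lemma mat_adjoint_carrier: "A \<in> carrier_mat n m \<Longrightarrow> mat_adjoint A \<in> carrier_mat m n"
  by (rule carrier_matI) (simp_all add: mat_adjoint_def)

text \<open>The outer factors alone fix the dimensions, whatever value
  \<open>the (mat_inverse L)\<close> has.\<close>

lemma schur_compl_carrier: "schur_compl a b0 n \<in> carrier_mat (2 * n - 1) (2 * n - 1)"
proof -
  have "X - circ_B a b0 n * Y * mat_adjoint (circ_B a b0 n) \<in> carrier_mat (2 * n - 1) (2 * n - 1)"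
    for X Y
    using carrier_matD[OF circ_B_carrier[of a b0 n]]
      carrier_matD[OF mat_adjoint_carrier[OF circ_B_carrier[of a b0 n]]]
    by (intro carrier_matI) (simp_all only: index_minus_mat index_mult_mat)
  then show ?thesis unfolding schur_compl_def Let_def .
qed

text \<open>Block elimination: the Schur complement equation is the circulant one with right-hand side
  supported in the second block.\<close>

lemma schur_compl_lift:
  assumes herm: "\<And>k. a (- k) = cnj (a k)" and b0: "b0 \<in> \<real>"
    and inj: "\<And>p. p \<in> carrier_vec (2 * n - 1) \<Longrightarrow>
      mat_section (toeplitz a) n *\<^sub>v p = 0\<^sub>v (2 * n - 1) \<Longrightarrow> p = 0\<^sub>v (2 * n - 1)"
    and z: "z \<in> carrier_vec (2 * n - 1)"
  obtains p where "p \<in> carrier_vec (2 * n - 1)"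
    "circ_embedding a b0 n *\<^sub>v (p @\<^sub>v z) = 0\<^sub>v (2 * n - 1) @\<^sub>v (schur_compl a b0 n *\<^sub>v z)"
proof -
  define m where "m = 2 * n - 1"
  define L where "L = mat_section (toeplitz a) n"
  define B where "B = circ_B a b0 n"
  define B' where "B' = mat_adjoint B"
  have L: "L \<in> carrier_mat m m" by (simp add: L_def mat_section_def m_def)
  have B: "B \<in> carrier_mat m m" using circ_B_carrier by (simp add: B_def m_def)
  have B': "B' \<in> carrier_mat m m" unfolding B'_def by (rule mat_adjoint_carrier[OF B])
  have z: "z \<in> carrier_vec m" using z by (simp add: m_def)
  have "det L \<noteq> 0" using injective_mat_imp_det_nonzero[OF L] inj by (simp add: L_def m_def)
  then obtain X where X: "mat_inverse L = Some X" "X \<in> carrier_mat m m" "L * X = 1\<^sub>m m"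
    by (rule det_nonzero_mat_inverse[OF L])
  \<comment> \<open>The first block of the lift is \<open>- r\<close>: it solves the upper block
    row, and inserting it in the lower one leaves the Schur complement applied to
    \<open>z\<close>.\<close>
  define r where "r = X *\<^sub>v (B' *\<^sub>v z)"
  have Bz: "B' *\<^sub>v z \<in> carrier_vec m" using B' z by simp
  have r: "r \<in> carrier_vec m" using X Bz by (simp add: r_def)
  have Lr: "L *\<^sub>v r = B' *\<^sub>v z"
    unfolding r_def using L X Bz by (simp add: assoc_mult_mat_vec[symmetric])
  have S: "schur_compl a b0 n = L - B * X * B'"
    by (simp add: schur_compl_def Let_def L_def[symmetric] B_def[symmetric] B'_def X(1))
  have Sz: "schur_compl a b0 n *\<^sub>v z = L *\<^sub>v z - B *\<^sub>v r"
  proof -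
    have "schur_compl a b0 n *\<^sub>v z = L *\<^sub>v z - (B * X * B') *\<^sub>v z"
      unfolding S using L B X B' z by (intro minus_mult_distrib_mat_vec) auto
    also have "(B * X * B') *\<^sub>v z = B *\<^sub>v r"
      unfolding r_def assoc_mult_mat_vec[OF mult_carrier_mat[OF B X(2)] B' z]
      by (rule assoc_mult_mat_vec[OF B X(2) Bz])
    finally show ?thesis .
  qed
  have neg: "A *\<^sub>v (- r) = - (A *\<^sub>v r)" if "A \<in> carrier_mat m m" for A
    using mult_mat_vec[OF that r, of "- 1"] that r
    by (intro eq_vecI) (auto simp del: mult_mat_vec)
  have Br: "B *\<^sub>v r \<in> carrier_vec m" and Lz: "L *\<^sub>v z \<in> carrier_vec m"
    using L B r z by auto
  have "circ_embedding a b0 n *\<^sub>v ((- r) @\<^sub>v z)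
      = (L *\<^sub>v (- r) + B' *\<^sub>v z) @\<^sub>v (B *\<^sub>v (- r) + L *\<^sub>v z)"
    unfolding circ_embedding_block[of a b0 n, OF herm b0] L_def[symmetric] B_def[symmetric] B'_def[symmetric]
    using L B B' r z by (intro four_block_mat_mult_vec) auto
  also have "L *\<^sub>v (- r) + B' *\<^sub>v z = 0\<^sub>v m"
    using Bz by (simp add: neg[OF L] Lr)
  also have "B *\<^sub>v (- r) + L *\<^sub>v z = schur_compl a b0 n *\<^sub>v z"
    unfolding Sz neg[OF B] using Br Lz
    by (simp add: minus_add_uminus_vec[of _ m] comm_add_vec[of _ m])
  finally show thesis using that[of "- r"] r by (simp add: m_def)
qed

section \<open>Circulant matrices acting on periodic sequences\<close>

text \<open>A circulant matrix is a cyclic convolution. Taking the offsets from the centred residue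
  system 1 - m, ..., m makes its coefficients equal to those of the Toeplitz matrix, except possibly
  at j = m.\<close>

lemma circ_embedding_mult_periodic:
  fixes a :: "int \<Rightarrow> complex" and n :: nat
  defines "m \<equiv> 2 * n - 1"
  assumes herm: "\<And>k. a (- k) = cnj (a k)" and n: "n \<ge> 1" and w: "w \<in> carrier_vec (2 * m)"
  shows "(circ_embedding a b0 n *\<^sub>v w) $ nat (q mod int (2 * m))
    = (\<Sum>j\<in>{1 - int m..int m}. (if j = int m then b0 else a j) * w $ nat ((q - j) mod int (2 * m)))"
proof -
  have m: "m \<ge> 1" using n by (simp add: m_def)
  define M where "M = int (2 * m)"
  have M: "M > 0" "M = 2 * int m" using m by (auto simp: M_def)
  define i where "i = nat (q mod M)"
  have i: "i < 2 * m" "int i = q mod M" using M by (auto simp: i_def nat_less_iff)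
  have nat_less: "nat (r mod M) < 2 * m" for r
    using M by (simp add: nat_less_iff)
  have coeff: "circ_coeff a b0 m (nat (j mod M)) = (if j = int m then b0 else a j)"
    if "j \<in> {1 - int m..int m}" for j
  proof (cases "j \<ge> 0")
    case True
    then have "j mod M = j" using that M m by (intro mod_pos_pos_trivial) auto
    then show ?thesis using True that by (auto simp: circ_coeff_def)
  next
    case False
    have "j mod M = (j + M) mod M" by simp
    also have "\<dots> = j + M" using False that M m by (intro mod_pos_pos_trivial) auto
    finally have "j mod M = j + M" .
    moreover have "int (2 * m - nat (j + M)) = - j" using False that M by auto
    ultimately show ?thesis
      using False that M herm[of j] by (auto simp: circ_coeff_def nat_less_iff)
  qed
  have C: "circ_embedding a b0 n
      = mat (2 * m) (2 * m) (\<lambda>(k, l). circ_coeff a b0 m (nat ((int k - int l) mod M)))"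
    by (simp add: circ_embedding_def Let_def m_def M_def)
  have "(circ_embedding a b0 n *\<^sub>v w) $ i
      = (\<Sum>l<2 * m. circ_coeff a b0 m (nat ((int i - int l) mod M)) * w $ l)"
    using i w unfolding C by (simp add: scalar_prod_def lessThan_atLeast0)
  also have "\<dots> = (\<Sum>j\<in>{1 - int m..int m}. circ_coeff a b0 m (nat (j mod M)) * w $ nat ((q - j) mod M))"
  \<comment> \<open>Adding m - 1 before the reduction and subtracting it afterwards selects the
    representative of the offset between 1 - m and m.\<close>
  proof (rule sum.reindex_bij_witness[where i = "\<lambda>j. nat ((q - j) mod M)"
        and j = "\<lambda>l. (q - int l + (int m - 1)) mod M - (int m - 1)"])
    fix l assume l: "l \<in> {..<2 * m}"
    let ?j = "(q - int l + (int m - 1)) mod M - (int m - 1)"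
    have "(q - ?j) mod M = (q + (int m - 1) - (q - int l + (int m - 1)) mod M) mod M"
      by (simp add: algebra_simps)
    also have "\<dots> = (q + (int m - 1) - (q - int l + (int m - 1))) mod M"
      by (rule mod_diff_right_eq)
    also have "q + (int m - 1) - (q - int l + (int m - 1)) = int l" by simp
    also have "int l mod M = int l" using l M by simp
    finally have ql: "(q - ?j) mod M = int l" .
    then show "nat ((q - ?j) mod M) = l" by simp
    have "0 \<le> (q - int l + (int m - 1)) mod M" "(q - int l + (int m - 1)) mod M < M"
      using M by auto
    then show "?j \<in> {1 - int m..int m}" using M(2) unfolding atLeastAtMost_iff by linarith
    have "?j mod M = (q - int l) mod M" by (simp add: mod_diff_left_eq)
    also have "\<dots> = (int i - int l) mod M" unfolding i(2) by (simp add: mod_diff_left_eq)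
    finally show "circ_coeff a b0 m (nat (?j mod M)) * w $ nat ((q - ?j) mod M)
        = circ_coeff a b0 m (nat ((int i - int l) mod M)) * w $ l"
      using ql by simp
  next
    fix j assume j: "j \<in> {1 - int m..int m}"
    show "nat ((q - j) mod M) \<in> {..<2 * m}" using nat_less by simp
    have "(q - int (nat ((q - j) mod M)) + (int m - 1)) mod M
        = (q + (int m - 1) - (q - j) mod M) mod M"
      using M by (simp add: algebra_simps)
    also have "\<dots> = (q + (int m - 1) - (q - j)) mod M" by (rule mod_diff_right_eq)
    also have "q + (int m - 1) - (q - j) = j + (int m - 1)" by simp
    also have "(j + (int m - 1)) mod M = j + (int m - 1)"
      using j M by (intro mod_pos_pos_trivial) auto
    finally show "(q - int (nat ((q - j) mod M)) + (int m - 1)) mod M - (int m - 1) = j" by simp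
  qed
  also have "\<dots> = (\<Sum>j\<in>{1 - int m..int m}. (if j = int m then b0 else a j) * w $ nat ((q - j) mod M))"
    by (intro sum.cong refl) (simp only: coeff)
  finally show ?thesis by (simp add: i_def M_def)
qed

lemma toeplitz_has_sum:
  fixes a w :: "int \<Rightarrow> complex"
  assumes "\<And>k. cmod (a k) \<le> C * exp (- \<gamma> * real_of_int \<bar>k\<bar>)" and "\<gamma> > 0"
    and "\<And>l. cmod (w l) \<le> B"
  shows "((\<lambda>l. a (k - l) * w l) has_sum bi_apply (toeplitz a) w k) UNIV"
  unfolding bi_apply_def toeplitz_def
  by (rule has_sum_infsum[OF abs_summable_summable[OF toeplitz_row_abs_summable[OF assms]]])

text \<open>On a periodic sequence both matrices act as convolutions, with coefficients that differ
  only for |j| \<ge> m. There half of the decay rate yields the small factor in m, and the other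
  half is summed. The shift \<open>s\<close> allows either block to be centred at 0.\<close>

lemma circulant_approximates_toeplitz:
  fixes a :: "int \<Rightarrow> complex" and n :: nat and \<gamma> C :: real
  defines "m \<equiv> 2 * n - 1"
  assumes decay: "\<And>k. cmod (a k) \<le> C * exp (- \<gamma> * real_of_int \<bar>k\<bar>)" and \<gamma>: "\<gamma> > 0"
    and herm: "\<And>k. a (- k) = cnj (a k)" and n: "n \<ge> 1"
    and b0: "b0 = 0 \<or> b0 = a (int m)"
    and w: "w \<in> carrier_vec (2 * m)" and bdd: "\<And>i. i < 2 * m \<Longrightarrow> cmod (w $ i) \<le> B"
  shows "cmod (bi_apply (toeplitz a) (\<lambda>l. w $ nat ((l + s) mod int (2 * m))) k
      - (circ_embedding a b0 n *\<^sub>v w) $ nat ((k + s) mod int (2 * m)))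
    \<le> C * (\<Sum>\<^sub>\<infinity>j::int. exp (- (\<gamma> / 2) * real_of_int \<bar>j\<bar>)) * exp (- (\<gamma> / 2) * real m) * B"
proof -
  define W where "W = (\<lambda>l. w $ nat ((l + s) mod int (2 * m)))"
  have m: "m \<ge> 1" using n by (simp add: m_def)
  have W: "cmod (W l) \<le> B" for l
    unfolding W_def using m by (intro bdd) (simp add: nat_less_iff)
  have B: "B \<ge> 0" using order.trans[OF norm_ge_zero W[of 0]] .
  have C: "C \<ge> 0" using order.trans[OF norm_ge_zero decay[of 0]] by simp
  define J where "J = {1 - int m..int m}"
  define c where "c = (\<lambda>j. if j \<in> J then (if j = int m then b0 else a j) else 0)"
  have circ: "(circ_embedding a b0 n *\<^sub>v w) $ nat ((k + s) mod int (2 * m)) = (\<Sum>j\<in>J. c j * W (k - j))"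
    unfolding m_def circ_embedding_mult_periodic[where a = a, OF herm n w[unfolded m_def]]
    unfolding m_def[symmetric] J_def[symmetric]
    by (intro sum.cong) (auto simp: c_def W_def algebra_simps)
  have "((\<lambda>j. c j * W (k - j)) has_sum (\<Sum>j\<in>J. c j * W (k - j))) UNIV"
    by (rule has_sum_finite_neutralI[of J]) (auto simp: J_def c_def)
  moreover have "((\<lambda>j. a j * W (k - j)) has_sum bi_apply (toeplitz a) W k) UNIV"
  proof -
    have bij: "bij_betw (\<lambda>j. k - j) UNIV (UNIV :: int set)"
      by (rule bij_betw_byWitness[where f' = "\<lambda>j. k - j"]) auto
    have "((\<lambda>l. a (k - l) * W l) has_sum bi_apply (toeplitz a) W k) UNIV"
      by (rule toeplitz_has_sum[OF decay \<gamma> W])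
    then show ?thesis
      using has_sum_reindex_bij_betw[OF bij, of "\<lambda>l. a (k - l) * W l"] by simp
  qed
  ultimately have diff: "((\<lambda>j. a j * W (k - j) + - (c j * W (k - j))) has_sum
      bi_apply (toeplitz a) W k + - (\<Sum>j\<in>J. c j * W (k - j))) UNIV"
    by (intro has_sum_add has_sum_uminusI)
  have maj: "((\<lambda>j. C * exp (- (\<gamma> / 2) * real m) * B * exp (- (\<gamma> / 2) * real_of_int \<bar>j\<bar>)) has_sum
      C * exp (- (\<gamma> / 2) * real m) * B * (\<Sum>\<^sub>\<infinity>j::int. exp (- (\<gamma> / 2) * real_of_int \<bar>j\<bar>))) UNIV"
    using exp_neg_abs_summable[of "\<gamma> / 2" 0] \<gamma>
    by (intro has_sum_cmult_right has_sum_infsum) auto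
  have coeff: "cmod (a j - c j) \<le> C * exp (- (\<gamma> / 2) * real m) * exp (- (\<gamma> / 2) * real_of_int \<bar>j\<bar>)"
    for j
  proof (cases "\<bar>j\<bar> < int m")
    case True
    then show ?thesis using C by (auto simp: c_def J_def)
  next
    case False
    \<comment> \<open>At j = m the difference is 0 or a_m, depending on \<open>b0\<close>; at the
      other j of this case \<open>c j\<close> is 0.\<close>
    have "cmod (a j - c j) \<le> cmod (a j)" using False b0 by (auto simp: c_def J_def)
    also have "\<dots> \<le> C * exp (- \<gamma> * real_of_int \<bar>j\<bar>)" by (rule decay)
    also have "\<dots> \<le> C * (exp (- (\<gamma> / 2) * real m) * exp (- (\<gamma> / 2) * real_of_int \<bar>j\<bar>))"
    proof (rule mult_left_mono[OF _ C])
      have "real m \<le> real_of_int \<bar>j\<bar>" using False by linarith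
      then have "(\<gamma> / 2) * real m \<le> (\<gamma> / 2) * real_of_int \<bar>j\<bar>"
        using \<gamma> by (intro mult_left_mono) auto
      then show "exp (- \<gamma> * real_of_int \<bar>j\<bar>)
          \<le> exp (- (\<gamma> / 2) * real m) * exp (- (\<gamma> / 2) * real_of_int \<bar>j\<bar>)"
        unfolding exp_add[symmetric] exp_le_cancel_iff by (simp add: field_simps)
    qed
    finally show ?thesis by simp
  qed
  have "cmod (bi_apply (toeplitz a) W k + - (\<Sum>j\<in>J. c j * W (k - j)))
      \<le> C * exp (- (\<gamma> / 2) * real m) * B * (\<Sum>\<^sub>\<infinity>j::int. exp (- (\<gamma> / 2) * real_of_int \<bar>j\<bar>))"
  proof (rule norm_infsum_le[OF diff maj])
    fix j
    have "cmod (a j * W (k - j) + - (c j * W (k - j))) = cmod (a j - c j) * cmod (W (k - j))"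
      by (simp add: norm_mult[symmetric] left_diff_distrib)
    also have "\<dots> \<le> C * exp (- (\<gamma> / 2) * real m) * exp (- (\<gamma> / 2) * real_of_int \<bar>j\<bar>) * B"
      using C by (intro mult_mono coeff W) auto
    finally show "cmod (a j * W (k - j) + - (c j * W (k - j)))
        \<le> C * exp (- (\<gamma> / 2) * real m) * B * exp (- (\<gamma> / 2) * real_of_int \<bar>j\<bar>)"
      by (simp add: mult_ac)
  qed
  then show ?thesis unfolding circ W_def[symmetric] by (simp add: mult_ac)
qed

text \<open>Apply the supremum bound for the Toeplitz operator to the periodic extension of
  \<open>w\<close>. The approximation error is \<eta> times the largest entry of \<open>w\<close>;
  this maximum is attained, so \<eta> K \<le> 1/2 lets it be absorbed.\<close>

lemma circulant_stable:
  fixes a :: "int \<Rightarrow> complex" and n :: nat and K \<eta> :: real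
  defines "m \<equiv> 2 * n - 1"
  assumes n: "n \<ge> 1" and K: "K > 0" and "K * \<eta> \<le> 1 / 2"
    and bound: "\<And>w B k0 M. (\<And>l. cmod (w l) \<le> B) \<Longrightarrow>
       (\<And>l. cmod (bi_apply (toeplitz a) w l) \<le> M) \<Longrightarrow> cmod (w k0) \<le> K * M"
    and approx: "\<And>B k. (\<And>i. i < 2 * m \<Longrightarrow> cmod (w $ i) \<le> B) \<Longrightarrow>
      cmod (bi_apply (toeplitz a) (\<lambda>l. w $ nat (l mod int (2 * m))) k - f (nat (k mod int (2 * m))))
        \<le> \<eta> * B"
    and f: "\<And>i. i < 2 * m \<Longrightarrow> cmod (f i) \<le> F" and i: "i < 2 * m"
  shows "cmod (w $ i) \<le> 2 * K * F"
proof -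
  define B where "B = Max ((\<lambda>i. cmod (w $ i)) ` {..<2 * m})"
  have m: "m \<ge> 1" using n by (simp add: m_def)
  have B: "cmod (w $ i) \<le> B" if "i < 2 * m" for i
    unfolding B_def using that by (intro Max_ge) auto
  have nat_less: "nat (k mod int (2 * m)) < 2 * m" for k
    using m by (simp add: nat_less_iff)
  have Lw: "cmod (bi_apply (toeplitz a) (\<lambda>l. w $ nat (l mod int (2 * m))) k) \<le> F + \<eta> * B" for k
    using approx[OF B, of k] f[OF nat_less[of k]]
    by (smt (verit) norm_triangle_sub)
  have "cmod (w $ j) \<le> K * (F + \<eta> * B)" if "j < 2 * m" for j
    using bound[OF B[OF nat_less] Lw, of "int j"] that by simp
  moreover have "B \<in> (\<lambda>i. cmod (w $ i)) ` {..<2 * m}"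
    unfolding B_def using m by (intro Max_in) (auto simp: lessThan_empty_iff)
  ultimately have "B \<le> K * (F + \<eta> * B)" by auto
  also have "\<dots> = K * F + (K * \<eta>) * B" by (simp add: algebra_simps)
  also have "\<dots> \<le> K * F + 1 / 2 * B"
    using assms(4) order.trans[OF norm_ge_zero B[OF i]] by (intro add_left_mono mult_right_mono)
  finally have "B \<le> 2 * K * F" by simp
  then show ?thesis using B[OF i] by linarith
qed

section \<open>Convergence of the circulant approximation\<close>

theorem corollary4p2:
  fixes a x y :: "int \<Rightarrow> complex" and \<gamma> :: real and b :: "nat \<Rightarrow> complex"
  assumes "bi_hermitian_pos_def (toeplitz a)"
    and "\<gamma> > 0"
    and "\<exists>C>0. \<forall>k. cmod (a k) < C * exp (- \<gamma> * real_of_int \<bar>k\<bar>)"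
    and "\<forall>k. cmod (y k) \<le> exp (- \<gamma> * real_of_int \<bar>k\<bar>)"
    and "x \<in> ell2"
    and "bi_apply (toeplitz a) x = y"
    and "\<forall>n\<ge>1. b n = 0 \<or> (a (int (2 * n - 1)) \<in> \<real> \<and> b n = a (int (2 * n - 1)))"
  shows "\<exists>(N::nat) (\<gamma>\<^sub>1::real) (c::real). 0 < \<gamma>\<^sub>1 \<and> \<gamma>\<^sub>1 < \<gamma> \<and>
           (\<forall>n>N. invertible_mat (schur_compl a (b n) n) \<and>
              (\<forall>z \<in> carrier_vec (2 * n - 1).
                 schur_compl a (b n) n *\<^sub>v z = vec_section y n \<longrightarrow>
                 ell2_norm (\<lambda>k. x k - extend_by_zero n z k) \<le> c * exp (- \<gamma>\<^sub>1 * real n)))"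
proof -

  \<comment> \<open>Pointwise estimates for the Toeplitz operator\<close>
  let ?L = "bi_apply (toeplitz a)"
  obtain C where C: "C > 0" and decay: "\<And>k. cmod (a k) \<le> C * exp (- \<gamma> * real_of_int \<bar>k\<bar>)"
    using assms(3) by (auto intro: less_imp_le)
  have y_le: "cmod (y k) \<le> exp (- \<gamma> * real_of_int \<bar>k\<bar>)" for k using assms(4) by blast
  have herm: "a (- k) = cnj (a k)" for k
    using bi_hermitian_pos_def_adjoint[OF assms(1), of 0 k] by (simp add: toeplitz_def)
  have op: "ell2_bounded_op ?L" "ell2_boundedly_invertible ?L"
    using assms(1) unfolding bi_hermitian_pos_def_def bi_bounded_def by blast+
  obtain K0 where "K0 > 0" "\<And>u. u \<in> ell2 \<Longrightarrow> ell2_norm u \<le> K0 * ell2_norm (?L u)"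
    using boundedly_invertible_bounded_below[OF op] by blast
  from toeplitz_local_bound[OF decay \<open>\<gamma> > 0\<close> \<open>C > 0\<close> this]
  obtain \<epsilon> K where \<epsilon>: "\<epsilon> > 0" "2 * \<epsilon> < \<gamma>" and K: "K > 0"
    and loc: "\<And>w B k0 M. (\<And>l. cmod (w l) \<le> B) \<Longrightarrow>
       (\<And>l. cmod (?L w l) \<le> M * exp (\<epsilon> * real_of_int \<bar>l - k0\<bar>)) \<Longrightarrow> cmod (w k0) \<le> K * M"
    by metis
  \<comment> \<open>The exponential weight is at least 1, so the localised estimate contains the
    plain supremum bound.\<close>
  have sup_bound: "cmod (w k0) \<le> K * M"
    if bdd: "\<And>l. cmod (w l) \<le> B" and Lw: "\<And>l. cmod (?L w l) \<le> M" for w B k0 M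
  proof (rule loc[OF bdd])
    have M: "M \<ge> 0" using order.trans[OF norm_ge_zero Lw[of 0]] .
    show "cmod (?L w l) \<le> M * exp (\<epsilon> * real_of_int \<bar>l - k0\<bar>)" for l
    proof -
      have "M * 1 \<le> M * exp (\<epsilon> * real_of_int \<bar>l - k0\<bar>)"
        using M \<epsilon> by (intro mult_left_mono) auto
      then show ?thesis using Lw[of l] by simp
    qed
  qed

  \<comment> \<open>Exponential decay of the exact solution\<close>
  have x_bdd: "cmod (x k) \<le> \<bar>ell2_norm x\<bar>" for k
    using ell2_coord_le[OF assms(5), of k] by (metis abs_le_square_iff abs_norm_cancel)
  \<comment> \<open>Centre the estimate at \<open>k\<close> with M = exp (- \<epsilon> |k|): the
    decay of \<open>y\<close> fits because |k| \<le> |l| + |l - k|.\<close>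
  have x_decay: "cmod (x k) \<le> K * exp (- \<epsilon> * real_of_int \<bar>k\<bar>)" for k
  proof (rule loc[OF x_bdd])
    fix l
    have "\<epsilon> * real_of_int \<bar>k\<bar> \<le> \<epsilon> * (real_of_int \<bar>l\<bar> + real_of_int \<bar>l - k\<bar>)"
      using \<epsilon> by (intro mult_left_mono) linarith+
    moreover have "\<epsilon> * real_of_int \<bar>l\<bar> \<le> \<gamma> * real_of_int \<bar>l\<bar>"
      using \<epsilon> by (intro mult_right_mono) auto
    ultimately have "- \<gamma> * real_of_int \<bar>l\<bar> \<le> - \<epsilon> * real_of_int \<bar>k\<bar> + \<epsilon> * real_of_int \<bar>l - k\<bar>"
      by (simp add: algebra_simps)
    then show "cmod (?L x l) \<le> exp (- \<epsilon> * real_of_int \<bar>k\<bar>) * exp (\<epsilon> * real_of_int \<bar>l - k\<bar>)"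
      unfolding assms(6) exp_add[symmetric] using y_le[of l] by (meson exp_le_cancel_iff order.trans)
  qed

  \<comment> \<open>Choice of the threshold and the constants\<close>
  define A where "A = C * (\<Sum>\<^sub>\<infinity>j::int. exp (- (\<gamma> / 2) * real_of_int \<bar>j\<bar>))"
  have A: "A \<ge> 0" using C by (auto simp: A_def intro!: mult_nonneg_nonneg infsum_nonneg)
  have "(\<lambda>n. K * (A * exp (- \<epsilon> * real n))) \<longlonglongrightarrow> K * (A * 0)"
    using \<epsilon> by (intro tendsto_mult_left filterlim_compose[OF exp_at_bot]
        filterlim_tendsto_neg_mult_at_bot[OF tendsto_const] filterlim_real_sequentially) auto
  then have "\<forall>\<^sub>F n in sequentially. K * (A * exp (- \<epsilon> * real n)) < 1 / 2"
    by (rule order_tendstoD) simp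
  then obtain N where N: "\<And>n. n \<ge> N \<Longrightarrow> K * (A * exp (- \<epsilon> * real n)) \<le> 1 / 2"
    unfolding eventually_sequentially by (meson less_imp_le)
  \<comment> \<open>As max n |k| is at least the mean of n and |k|, decay at rate \<epsilon> in the
    maximum splits into rate \<epsilon> / 2 in n and in k separately.\<close>
  define \<kappa> where "\<kappa> = \<epsilon> / 2"
  \<comment> \<open>Sum of the constant \<open>K * (2 + 2 * K * A)\<close> for |k| < n and the
    constant \<open>K\<close> for |k| \<ge> n.\<close>
  define G where "G = K * (3 + 2 * K * A)"
  define c where "c = G * sqrt (\<Sum>\<^sub>\<infinity>j::int. exp (- \<epsilon> * real_of_int \<bar>j\<bar>))"
  have "invertible_mat (schur_compl a (b n) n) \<and>
      (\<forall>z \<in> carrier_vec (2 * n - 1). schur_compl a (b n) n *\<^sub>v z = vec_section y n \<longrightarrow>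
         ell2_norm (\<lambda>k. x k - extend_by_zero n z k) \<le> c * exp (- \<kappa> * real n))"
    if n: "n > N" for n
  proof -

    \<comment> \<open>Uniform stability and invertibility of the Schur complement\<close>
    define m where "m = 2 * n - 1"
    define S where "S = schur_compl a (b n) n"
    define \<eta> where "\<eta> = A * exp (- (\<gamma> / 2) * real m)"
    have n1: "n \<ge> 1" using n by simp
    have m: "int m = 2 * int n - 1" "m \<ge> n" "m \<ge> 1" using n1 by (auto simp: m_def)
    have S: "S \<in> carrier_mat m m" unfolding S_def m_def by (rule schur_compl_carrier)
    have bn: "b n = 0 \<or> b n = a (int m)" "b n \<in> \<real>" using assms(7) n1 by (auto simp: m_def)
    \<comment> \<open>The rates fit since \<epsilon> < \<gamma> / 2 and n \<le> m.\<close>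
    have \<eta>_le: "\<eta> \<le> A * exp (- \<epsilon> * real n)"
    proof -
      have "\<epsilon> * real n \<le> (\<gamma> / 2) * real m" using \<epsilon> m by (intro mult_mono) auto
      then show ?thesis unfolding \<eta>_def using A by (intro mult_left_mono) auto
    qed
    have K\<eta>: "K * \<eta> \<le> 1 / 2"
      using mult_left_mono[OF \<eta>_le, of K] N[of n] n K by linarith
    have lift: "\<exists>p\<in>carrier_vec m. circ_embedding a (b n) n *\<^sub>v (p @\<^sub>v z) = 0\<^sub>v m @\<^sub>v (S *\<^sub>v z)"
      if z: "z \<in> carrier_vec m" for z
    proof -
      obtain p where "p \<in> carrier_vec (2 * n - 1)" "circ_embedding a (b n) n *\<^sub>v (p @\<^sub>v z)
          = 0\<^sub>v (2 * n - 1) @\<^sub>v (schur_compl a (b n) n *\<^sub>v z)"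
        by (rule schur_compl_lift[of a "b n" n z, OF herm bn(2) mat_section_injective[OF assms(1)]
              z[unfolded m_def]])
      then show ?thesis unfolding m_def S_def by blast
    qed
    have approx: "cmod (?L (\<lambda>l. w $ nat ((l + s) mod int (2 * m))) k
        - (circ_embedding a (b n) n *\<^sub>v w) $ nat ((k + s) mod int (2 * m))) \<le> \<eta> * B"
      if "w \<in> carrier_vec (2 * m)" "\<And>i. i < 2 * m \<Longrightarrow> cmod (w $ i) \<le> B" for w B s k
      using circulant_approximates_toeplitz[where a = a and n = n, OF decay assms(2) herm n1]
        that bn(1) unfolding m_def[symmetric] A_def[symmetric] \<eta>_def by blast
    have approx0: "cmod (?L (\<lambda>l. w $ nat (l mod int (2 * m))) k
        - (circ_embedding a (b n) n *\<^sub>v w) $ nat (k mod int (2 * m))) \<le> \<eta> * B"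
      if "w \<in> carrier_vec (2 * m)" "\<And>i. i < 2 * m \<Longrightarrow> cmod (w $ i) \<le> B" for w B k
      using approx[where w = w and B = B and s = 0 and k = k] that by simp
    have stable: "cmod (w $ i) \<le> 2 * K * F"
      if w: "w \<in> carrier_vec (2 * m)"
        and F: "\<And>i. i < 2 * m \<Longrightarrow> cmod ((circ_embedding a (b n) n *\<^sub>v w) $ i) \<le> F"
        and i: "i < 2 * m" for w F i
      by (rule circulant_stable[of n K \<eta> a w "\<lambda>i. (circ_embedding a (b n) n *\<^sub>v w) $ i" F i,
            folded m_def])
        (rule n1 K K\<eta> i | erule F | rule sup_bound, assumption+ | rule approx0[OF w], assumption)+
    \<comment> \<open>A kernel vector of \<open>S\<close> lifts to a kernel vector of the circulant
      matrix, which vanishes by stability with \<open>F = 0\<close>.\<close>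
    have "det S \<noteq> 0"
    proof (rule injective_mat_imp_det_nonzero[OF S])
      fix z :: "complex vec" assume z: "z \<in> carrier_vec m" "S *\<^sub>v z = 0\<^sub>v m"
      obtain p where p: "p \<in> carrier_vec m"
        "circ_embedding a (b n) n *\<^sub>v (p @\<^sub>v z) = 0\<^sub>v m @\<^sub>v (S *\<^sub>v z)"
        using lift[OF z(1)] by blast
      have w: "p @\<^sub>v z \<in> carrier_vec (2 * m)" using p z by (simp add: mult_2)
      have "cmod ((p @\<^sub>v z) $ i) \<le> 2 * K * 0" if "i < 2 * m" for i
        by (rule stable[OF w _ that]) (auto simp: p(2) z(2))
      then have "(p @\<^sub>v z) $ (m + i) = 0" if "i < m" for i using that by simp
      then show "z = 0\<^sub>v m" using p z by (intro eq_vecI) auto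
    qed
    then obtain T where "T \<in> carrier_mat m m" "S * T = 1\<^sub>m m" "T * S = 1\<^sub>m m"
      using det_nonzero_mat_inverse[OF S] by blast
    then have inv: "invertible_mat S"
      using S unfolding invertible_mat_def inverts_mat_def square_mat.simps by auto

    \<comment> \<open>Error of the circulant approximation\<close>
    have "ell2_norm (\<lambda>k. x k - extend_by_zero n z k) \<le> c * exp (- \<kappa> * real n)"
      if z: "z \<in> carrier_vec m" and Sz: "S *\<^sub>v z = vec_section y n" for z
    proof -
      obtain p where p: "p \<in> carrier_vec m"
        "circ_embedding a (b n) n *\<^sub>v (p @\<^sub>v z) = 0\<^sub>v m @\<^sub>v vec_section y n"
        using lift[OF z] Sz by auto
      define w where "w = p @\<^sub>v z"
      define f where "f = 0\<^sub>v m @\<^sub>v vec_section y n"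
      have w: "w \<in> carrier_vec (2 * m)" using p z by (simp add: w_def mult_2)
      have Cw: "circ_embedding a (b n) n *\<^sub>v w = f" using p by (simp add: w_def f_def)
      have y1: "cmod (y k) \<le> 1" for k using y_le[of k] \<open>\<gamma> > 0\<close> by (smt (verit) exp_le_one_iff mult_minus_left mult_nonneg_nonneg of_int_0_le_iff abs_ge_zero)
      have f_nth: "f $ i = (if i < m then 0 else y (int (i - m) - int n + 1))" if "i < 2 * m" for i
        using that by (auto simp: f_def vec_section_def m_def)
      have f1: "cmod (f $ i) \<le> 1" if "i < 2 * m" for i using f_nth[OF that] y1 by simp
      \<comment> \<open>Stability with \<open>F = 1\<close> gives a bound that does not depend on
        n.\<close>
      have w_le: "cmod (w $ i) \<le> 2 * K" if "i < 2 * m" for i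
        using stable[OF w _ that, of 1] f1 by (simp add: Cw)
      \<comment> \<open>This shift maps |k| < n onto the positions m, ..., 2m - 1 of the second
        block, where \<open>z\<close> stands.\<close>
      define s where "s = int m + int n - 1"
      define W where "W = (\<lambda>l. w $ nat ((l + s) mod int (2 * m)))"
      have nat_less: "nat (k mod int (2 * m)) < 2 * m" for k
        using m by (simp add: nat_less_iff)
      have W_le: "cmod (W l) \<le> 2 * K" for l unfolding W_def by (rule w_le[OF nat_less])
      have W_eq: "W k = extend_by_zero n z k" if "\<bar>k\<bar> < int n" for k
      proof -
        define i where "i = nat (k + int n - 1)"
        have i: "i < m" "k + s = int (m + i)" using that m by (auto simp: i_def s_def)
        have "(k + s) mod int (2 * m) = int (m + i)"
          using i by (subst mod_pos_pos_trivial) auto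
        then have "W k = w $ (m + i)" by (simp add: W_def del: of_nat_add)
        also have "\<dots> = z $ i" using i p z by (simp add: w_def)
        finally have "W k = z $ i" .
        moreover have "- int n + 1 \<le> k" "k \<le> int n - 1" using that by linarith+
        ultimately show ?thesis by (simp add: extend_by_zero_def i_def)
      qed
      define r where "r = (\<lambda>l. f $ nat ((l + s) mod int (2 * m)))"
      have LW: "cmod (?L W l - r l) \<le> \<eta> * (2 * K)" for l
        unfolding W_def r_def Cw[symmetric] by (rule approx[OF w w_le])
      have r_le: "cmod (r l) \<le> 1" for l unfolding r_def by (rule f1[OF nat_less])
      have r_in: "r l = y l" if "\<bar>l\<bar> < int n" for l
      proof -
        have "(l + s) mod int (2 * m) = l + s" using that m by (intro mod_pos_pos_trivial) (auto simp: s_def)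
        moreover have "int (nat (l + s) - m) - int n + 1 = l" "\<not> nat (l + s) < m"
          using that by (auto simp: s_def)
        ultimately show ?thesis using f_nth[OF nat_less, of "l + s"] by (simp add: r_def)
      qed
      \<comment> \<open>The period is 2m = 4n - 2, so the nearest other copies of the section of
        \<open>y\<close> begin at distance (4n - 2) - (n - 1) = 3n - 1 from 0.\<close>
      have r_mid: "r l = 0" if "int n \<le> \<bar>l\<bar>" "\<bar>l\<bar> \<le> 3 * int n - 2" for l
      proof -
        have "nat ((l + s) mod int (2 * m)) < m"
        proof (cases "l \<ge> 0")
          case True
          have "(l + s) mod int (2 * m) = (l + s - int (2 * m)) mod int (2 * m)" by simp
          also have "\<dots> = l + s - int (2 * m)"
            using that True m by (intro mod_pos_pos_trivial) (auto simp: s_def)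
          finally show ?thesis using that True m by (auto simp: s_def)
        next
          case False
          have "(l + s) mod int (2 * m) = l + s"
            using that False m by (intro mod_pos_pos_trivial) (auto simp: s_def)
          then show ?thesis using that False m by (auto simp: s_def)
        qed
        then show ?thesis using f_nth[OF nat_less, of "l + s"] by (simp add: r_def)
      qed
      have inner: "cmod (x k - W k) \<le> K * ((2 + 2 * K * A) * exp (- \<epsilon> * real n))"
        if k: "\<bar>k\<bar> < int n" for k
      proof (rule loc[of "\<lambda>l. x l - W l" _ _ k])
        show "cmod (x l - W l) \<le> \<bar>ell2_norm x\<bar> + 2 * K" for l
          using norm_triangle_ineq4[of "x l" "W l"] x_bdd[of l] W_le[of l] by linarith
        fix l
        have "((\<lambda>j. a (l - j) * x j + - (a (l - j) * W j)) has_sum ?L x l + - ?L W l) UNIV"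
          by (rule has_sum_add[OF toeplitz_has_sum[OF decay assms(2) x_bdd]
                has_sum_uminusI[OF toeplitz_has_sum[OF decay assms(2) W_le]]])
        moreover have "?L (\<lambda>l. x l - W l) l = (\<Sum>\<^sub>\<infinity>j. a (l - j) * x j + - (a (l - j) * W j))"
          unfolding bi_apply_def toeplitz_def by (intro infsum_cong) (simp add: right_diff_distrib)
        ultimately have L_diff: "?L (\<lambda>l. x l - W l) l = y l - ?L W l"
          unfolding assms(6) by (metis infsumI diff_conv_add_uminus)
        \<comment> \<open>The budget of the localised estimate at \<open>k\<close>. Up to |l| = 3n -
          2 the residual is of size exp (- \<epsilon> n). Beyond that it is only bounded, but then
          |l - k| \<ge> 2n, so the growing weight lifts \<open>E\<close> above 1.\<close>
        define E where "E = exp (- \<epsilon> * real n) * exp (\<epsilon> * real_of_int \<bar>l - k\<bar>)"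
        have exp_le: "exp (- \<epsilon> * real n) \<le> E" using \<epsilon> by (simp add: E_def)
        have yr: "cmod (y l - r l) \<le> 2 * E"
        proof -
          consider "\<bar>l\<bar> < int n" | "int n \<le> \<bar>l\<bar>" "\<bar>l\<bar> \<le> 3 * int n - 2" | "\<bar>l\<bar> \<ge> 3 * int n - 1"
            by linarith
          then show ?thesis
          proof cases
            case 1
            then show ?thesis by (simp add: r_in E_def)
          next
            case 2
            have "\<epsilon> * real n \<le> \<gamma> * real_of_int \<bar>l\<bar>"
              using \<epsilon> 2 by (intro mult_mono) auto
            then have "cmod (y l) \<le> exp (- \<epsilon> * real n)"
              using y_le[of l] by (smt (verit) exp_le_cancel_iff mult_minus_left)
            moreover have "cmod (y l - r l) = cmod (y l)" by (simp add: r_mid[OF 2])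
            moreover have "E \<ge> 0" by (simp add: E_def)
            ultimately show ?thesis using exp_le by linarith
          next
            case 3
            have "\<epsilon> * real n \<le> \<epsilon> * real_of_int \<bar>l - k\<bar>"
              using \<epsilon> 3 k n1 by (intro mult_left_mono) auto
            then have "1 \<le> E" by (simp add: E_def exp_add[symmetric])
            then show ?thesis
              using norm_triangle_ineq4[of "y l" "r l"] y1[of l] r_le[of l] by linarith
          qed
        qed
        have "\<eta> * (2 * K) \<le> A * E * (2 * K)"
          using \<eta>_le mult_left_mono[OF exp_le A] K by (intro mult_right_mono) auto
        then have "cmod (y l - ?L W l) \<le> 2 * E + A * E * (2 * K)"
          using norm_triangle_ineq4[of "y l - r l" "?L W l - r l"] yr LW[of l] by simp
        then show "cmod (?L (\<lambda>l. x l - W l) l)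
            \<le> (2 + 2 * K * A) * exp (- \<epsilon> * real n) * exp (\<epsilon> * real_of_int \<bar>l - k\<bar>)"
          unfolding L_diff E_def by (simp add: algebra_simps)
      qed
      have G: "K * (2 + 2 * K * A) \<le> G" "K \<le> G" "G \<ge> 0" using K A by (auto simp: G_def algebra_simps)
      \<comment> \<open>For |k| < n the periodic sequence coincides with \<open>z\<close>; for |k|
        \<ge> n the extension of \<open>z\<close> is 0 and the decay of \<open>x\<close>
        suffices.\<close>
      have err: "(cmod (x k - extend_by_zero n z k))\<^sup>2
          \<le> (G * exp (- \<kappa> * real n))\<^sup>2 * exp (- \<epsilon> * real_of_int \<bar>k\<bar>)" for k
      proof -
        have "cmod (x k - extend_by_zero n z k) \<le> G * exp (- \<epsilon> * max (real n) (real_of_int \<bar>k\<bar>))"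
        proof (cases "\<bar>k\<bar> < int n")
          case True
          then have "max (real n) (real_of_int \<bar>k\<bar>) = real n" by linarith
          moreover have "K * (2 + 2 * K * A) * exp (- \<epsilon> * real n) \<le> G * exp (- \<epsilon> * real n)"
            by (rule mult_right_mono[OF G(1)]) simp
          ultimately show ?thesis
            using inner[OF True] by (simp only: W_eq[OF True] mult.assoc)
        next
          case False
          then have "max (real n) (real_of_int \<bar>k\<bar>) = real_of_int \<bar>k\<bar>" by linarith
          moreover have "K * exp (- \<epsilon> * real_of_int \<bar>k\<bar>) \<le> G * exp (- \<epsilon> * real_of_int \<bar>k\<bar>)"
            by (rule mult_right_mono[OF G(2)]) simp
          moreover have "extend_by_zero n z k = 0" using False by (simp add: extend_by_zero_outside)
          ultimately show ?thesis using x_decay[of k] by (simp only: diff_zero)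
        qed
        also have "\<dots> \<le> G * exp (- \<kappa> * (real n + real_of_int \<bar>k\<bar>))"
        proof (intro mult_left_mono G(3))
          have "\<kappa> * (real n + real_of_int \<bar>k\<bar>) \<le> \<kappa> * (2 * max (real n) (real_of_int \<bar>k\<bar>))"
            using \<epsilon> by (intro mult_left_mono) (auto simp: \<kappa>_def)
          then show "exp (- \<epsilon> * max (real n) (real_of_int \<bar>k\<bar>))
              \<le> exp (- \<kappa> * (real n + real_of_int \<bar>k\<bar>))"
            by (simp add: \<kappa>_def)
        qed
        finally have "(cmod (x k - extend_by_zero n z k))\<^sup>2
            \<le> (G * exp (- \<kappa> * (real n + real_of_int \<bar>k\<bar>)))\<^sup>2"
          by (intro power_mono) auto
        also have "\<dots> = (G * exp (- \<kappa> * real n))\<^sup>2 * (exp (- \<kappa> * real_of_int \<bar>k\<bar>))\<^sup>2"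
          unfolding distrib_left exp_add by (simp add: power_mult_distrib)
        also have "(exp (- \<kappa> * real_of_int \<bar>k\<bar>))\<^sup>2 = exp (- \<epsilon> * real_of_int \<bar>k\<bar>)"
          by (simp add: \<kappa>_def power2_eq_square exp_add[symmetric])
        finally show ?thesis .
      qed
      have "(\<lambda>k. (G * exp (- \<kappa> * real n))\<^sup>2 * exp (- \<epsilon> * real_of_int \<bar>k\<bar>)) summable_on UNIV"
        using exp_neg_abs_summable[OF \<epsilon>(1), of 0] by (intro summable_on_cmult_right) simp
      from ell2_comparison(2)[OF this err]
      have "(ell2_norm (\<lambda>k. x k - extend_by_zero n z k))\<^sup>2
          \<le> (G * exp (- \<kappa> * real n))\<^sup>2 * (\<Sum>\<^sub>\<infinity>j::int. exp (- \<epsilon> * real_of_int \<bar>j\<bar>))"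
        by (simp only: infsum_cmult_right')
      then have "ell2_norm (\<lambda>k. x k - extend_by_zero n z k)
          \<le> sqrt ((G * exp (- \<kappa> * real n))\<^sup>2 * (\<Sum>\<^sub>\<infinity>j::int. exp (- \<epsilon> * real_of_int \<bar>j\<bar>)))"
        by (rule real_le_rsqrt)
      also have "\<dots> = c * exp (- \<kappa> * real n)"
        using G(3) by (simp add: real_sqrt_mult c_def)
      finally show ?thesis .
    qed
    then show ?thesis using inv unfolding S_def m_def by blast
  qed
  moreover have "0 < \<kappa>" "\<kappa> < \<gamma>" using \<epsilon> by (auto simp: \<kappa>_def)
  ultimately show ?thesis by blast
qed

end
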